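(* Let $B$ be a supersoluble brace such that $B/\zeta_n(B)$ is finite for some $n\in\mathbb{N}$. Then $\Gamma_{n+1}(B)$ is finite.
   Context: A brace (skew left brace) is a set $B$ with two binary operations $+$ and $\cdot$ such that $(B,+)$ and $(B,\cdot)$ are groups and $a(b+c)=ab-a+ac$ for all $a,b,c\in B$. $\lambda_a(b)=-a+ab$ defines a homomorphism $\lambda\colon(B,\cdot)\to\operatorname{Aut}(B,+)$; $a*b=-a+ab-b$, and for subsets $X,Y$, $X*Y$ is the additive subgroup generated by all $x*y$. An ideal is a subset that is a subgroup of both groups, normal in both, and invariant under all $\lambda_b$; quotients by ideals are braces. $\operatorname{Soc}(B)=\operatorname{Ker}\lambda\cap Z(B,+)$, $\zeta(B)=\operatorname{Soc}(B)\cap Z(B,\cdot)$; $\zeta_0(B)=\{0\}$, $\zeta_{k+1}(B)/\zeta_k(B)=\zeta(B/\zeta_k(B))$. The lower central series is $\Gamma_1(B)=B$, $\Gamma_{k+1}(B)=\langle \Gamma_k(B)*B,\ B*\Gamma_k(B),\ [\Gamma_k(B),B]_+\rangle_+$ (subgroup of $(B,+)$ generated, $[\,,]_+$ the commutator in $(B,+)$). $B$ is supersoluble if there is a finite chain of ideals $\{0\}=I_0\le\dots\le I_m=B$ such that for each $i$, either $(I_{i+1}/I_i,+)$ is infinite cyclic and $I_{i+1}/I_i\le\operatorname{Soc}(B/I_i)$, or $I_{i+1}/I_i$ has prime order. *)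

theory Defs
  imports "HOL-Algebra.Algebra"
begin

record 'a brace =
  bcar  :: "'a set"
  badd  :: "'a \<Rightarrow> 'a \<Rightarrow> 'a"
  bmul  :: "'a \<Rightarrow> 'a \<Rightarrow> 'a"
  bzero :: 'a
  bone  :: 'a

definition addG :: "'a brace \<Rightarrow> 'a monoid" where
  "addG B = \<lparr>carrier = bcar B, monoid.mult = badd B, one = bzero B\<rparr>"

definition mulG :: "'a brace \<Rightarrow> 'a monoid" where
  "mulG B = \<lparr>carrier = bcar B, monoid.mult = bmul B, one = bone B\<rparr>"

definition bneg :: "'a brace \<Rightarrow> 'a \<Rightarrow> 'a" where
  "bneg B a = inv\<^bsub>addG B\<^esub> a"

definition is_brace :: "'a brace \<Rightarrow> bool" where
  "is_brace B \<longleftrightarrow> group (addG B) \<and> group (mulG B) \<and>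
     (\<forall>a\<in>bcar B. \<forall>b\<in>bcar B. \<forall>c\<in>bcar B.
        bmul B a (badd B b c) = badd B (badd B (bmul B a b) (bneg B a)) (bmul B a c))"

definition blambda :: "'a brace \<Rightarrow> 'a \<Rightarrow> 'a \<Rightarrow> 'a" where
  "blambda B a b = badd B (bneg B a) (bmul B a b)"

definition bstar :: "'a brace \<Rightarrow> 'a \<Rightarrow> 'a \<Rightarrow> 'a" where
  "bstar B a b = badd B (badd B (bneg B a) (bmul B a b)) (bneg B b)"

definition bstar_set :: "'a brace \<Rightarrow> 'a set \<Rightarrow> 'a set \<Rightarrow> 'a set" where
  "bstar_set B S T = generate (addG B) {bstar B x y | x y. x \<in> S \<and> y \<in> T}"

definition add_comm :: "'a brace \<Rightarrow> 'a \<Rightarrow> 'a \<Rightarrow> 'a" where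
  "add_comm B x y = badd B (badd B (badd B (bneg B x) (bneg B y)) x) y"

definition grp_center :: "('a, 'b) monoid_scheme \<Rightarrow> 'a set" where
  "grp_center G = {z \<in> carrier G. \<forall>g\<in>carrier G. z \<otimes>\<^bsub>G\<^esub> g = g \<otimes>\<^bsub>G\<^esub> z}"

definition ker_lambda :: "'a brace \<Rightarrow> 'a set" where
  "ker_lambda B = {a \<in> bcar B. \<forall>b\<in>bcar B. blambda B a b = b}"

definition Soc :: "'a brace \<Rightarrow> 'a set" where
  "Soc B = ker_lambda B \<inter> grp_center (addG B)"

definition bzeta :: "'a brace \<Rightarrow> 'a set" where
  "bzeta B = Soc B \<inter> grp_center (mulG B)"

definition brace_ideal :: "'a set \<Rightarrow> 'a brace \<Rightarrow> bool" where
  "brace_ideal I B \<longleftrightarrow> I \<lhd> addG B \<and> I \<lhd> mulG B \<and>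
     (\<forall>b\<in>bcar B. \<forall>x\<in>I. blambda B b x \<in> I)"

text \<open>Quotient brace B/I: elements are the cosets x + I (= xI for an ideal I);
  operations are the induced set products in the two groups.\<close>
definition quot :: "'a brace \<Rightarrow> 'a set \<Rightarrow> 'a set brace" where
  "quot B I = \<lparr>bcar = rcosets\<^bsub>addG B\<^esub> I,
               badd = (\<lambda>U V. set_mult (addG B) U V),
               bmul = (\<lambda>U V. set_mult (mulG B) U V),
               bzero = I, bone = I\<rparr>"

definition quot_sub :: "'a brace \<Rightarrow> 'a set \<Rightarrow> 'a set \<Rightarrow> 'a set set" where
  "quot_sub B J I = {I #>\<^bsub>addG B\<^esub> x | x. x \<in> J}"

text \<open>Upper socle series: zeta_0 = {0}, zeta_{k+1}/zeta_k = zeta(B/zeta_k)\<close>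
fun upper_zeta :: "'a brace \<Rightarrow> nat \<Rightarrow> 'a set" where
  "upper_zeta B 0 = {bzero B}"
| "upper_zeta B (Suc k) = \<Union> (bzeta (quot B (upper_zeta B k)))"

fun Gamma :: "'a brace \<Rightarrow> nat \<Rightarrow> 'a set" where
  "Gamma B 0 = bcar B"
| "Gamma B (Suc 0) = bcar B"
| "Gamma B (Suc (Suc k)) =
     generate (addG B) (bstar_set B (Gamma B (Suc k)) (bcar B)
                        \<union> bstar_set B (bcar B) (Gamma B (Suc k))
                        \<union> {add_comm B x y | x y. x \<in> Gamma B (Suc k) \<and> y \<in> bcar B})"

definition supersoluble :: "'a brace \<Rightarrow> bool" where
  "supersoluble B \<longleftrightarrow> (\<exists>(I :: nat \<Rightarrow> 'a set) m.
     I 0 = {bzero B} \<and> I m = bcar B \<and>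
     (\<forall>i\<le>m. brace_ideal (I i) B) \<and>
     (\<forall>i<m. I i \<subseteq> I (Suc i) \<and>
        ((infinite (quot_sub B (I (Suc i)) (I i)) \<and>
          (\<exists>g\<in>quot_sub B (I (Suc i)) (I i).
             quot_sub B (I (Suc i)) (I i) = generate (addG (quot B (I i))) {g}) \<and>
          quot_sub B (I (Suc i)) (I i) \<subseteq> Soc (quot B (I i)))
         \<or> Factorial_Ring.prime (card (quot_sub B (I (Suc i)) (I i))))))"

end

theory Submission
  imports Defs
begin

text \<open>
Let \<open>K\<close> be an ideal that is finite modulo \<open>K \<inter> \<zeta>(B)\<close>. The transfer homomorphism into this central
subgroup shows that the torsion elements of \<open>(K, +)\<close> form a subgroup \<open>T\<close> and that \<open>x - y \<in> T\<close> whenever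
\<open>r x = r y\<close> for some \<open>r > 0\<close>; supersolubility makes \<open>T\<close> finite. Every additive endomorphism
fixing \<open>\<zeta>(B)\<close> and preserving \<open>K\<close> therefore acts trivially on \<open>K/T\<close>, so \<open>[K, B]\<close> and \<open>B * K\<close> lie in \<open>T\<close>.
As a consequence \<open>k \<mapsto> k * b\<close> is a homomorphism modulo \<open>T\<close>; it has finitely many values, and so \<open>K * B\<close>
lies in \<open>T\<close> too. Applying this to \<open>\<Gamma>\<^sub>k(B)\<close> modulo \<open>\<zeta>\<^sub>j(B)\<close> shows by induction on \<open>k\<close> that the image of \<open>\<Gamma>\<^sub>k\<^sub>+\<^sub>1(B)\<close>
in \<open>B/\<zeta>\<^sub>n\<^sub>-\<^sub>k(B)\<close> is finite.
\<close>

section \<open>Torsion in groups\<close>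

definition torsion :: "('a, 'b) monoid_scheme \<Rightarrow> 'a \<Rightarrow> bool" where
  "torsion G x \<longleftrightarrow> (\<exists>n>0. x [^]\<^bsub>G\<^esub> (n::nat) = \<one>\<^bsub>G\<^esub>)"

context group
begin

lemma inv_cancel_left:
  assumes "x \<in> carrier G" "y \<in> carrier G"
  shows "inv x \<otimes> (x \<otimes> y) = y" and "x \<otimes> (inv x \<otimes> y) = y"
  using assms by (simp_all add: m_assoc[symmetric])

text \<open>This is the transfer into \<open>C\<close>: compare a transversal with its translate by
  \<open>g\<close> and multiply the correction factors over all cosets. Translation permutes the
  cosets, so the product is multiplicative in \<open>g\<close>. An element of \<open>C\<close> fixes
  every coset and commutes with every representative, so it contributes itself once per coset and
  \<open>N\<close> is the index.\<close>

lemma central_transfer: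
  assumes C: "subgroup C G" and central: "C \<subseteq> grp_center G" and fin: "finite (rcosets C)"
  obtains V N where "V \<in> hom G G" "V ` carrier G \<subseteq> C" "N > (0::nat)" "\<And>c. c \<in> C \<Longrightarrow> V c = c [^] N"
proof -
  interpret C: subgroup C G by (rule C)
  define s where "s u = (SOME x. x \<in> u)" for u :: "'a set"
  have s: "s u \<in> u" if "u \<in> rcosets C" for u
  proof -
    have "\<exists>x. x \<in> u" using that C.rcosets_non_empty[OF that] by auto
    then show ?thesis unfolding s_def by (rule someI_ex)
  qed
  have sc: "s u \<in> carrier G" if "u \<in> rcosets C" for u
    using s[OF that] C.rcosets_carrier[OF is_group that] by blast
  have us: "u = C #> s u" if "u \<in> rcosets C" for u
    using that s[OF that] repr_independence C unfolding RCOSETS_def by auto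
  have ug: "u #> g \<in> rcosets C" if "u \<in> rcosets C" "g \<in> carrier G" for u g
    using that coset_mult_assoc[OF C.subset] unfolding RCOSETS_def by auto
  have ugh: "u #> g #> h = u #> (g \<otimes> h)" if "u \<in> rcosets C" "g \<in> carrier G" "h \<in> carrier G" for u g h
    using that coset_mult_assoc C.rcosets_carrier[OF is_group] by blast
  \<comment> \<open>\<open>c u g\<close> is the element of \<open>C\<close> that carries the
    representative of \<open>u #> g\<close> to \<open>s u \<otimes> g\<close>; \<open>cmul\<close>
    is its cocycle identity.\<close>
  define c where "c u g = s u \<otimes> g \<otimes> inv (s (u #> g))" for u g
  have cC: "c u g \<in> C" if "u \<in> rcosets C" "g \<in> carrier G" for u g
  proof -
    have "s u \<otimes> g \<in> C #> (s u \<otimes> g)" using that sc rcos_self C by auto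
    also have "C #> (s u \<otimes> g) = u #> g" using us[OF that(1)] coset_mult_assoc[OF C.subset] sc that by metis
    also have "\<dots> = C #> s (u #> g)" using us ug that by blast
    finally obtain d where "d \<in> C" "s u \<otimes> g = d \<otimes> s (u #> g)" unfolding r_coset_def by auto
    then show ?thesis unfolding c_def using sc ug that by (simp add: m_assoc)
  qed
  have cmul: "c u (g \<otimes> h) = c u g \<otimes> c (u #> g) h"
    if "u \<in> rcosets C" "g \<in> carrier G" "h \<in> carrier G" for u g h
    using that sc ug ugh unfolding c_def by (simp add: m_assoc inv_cancel_left)
  \<comment> \<open>Centrality makes \<open>C\<close> commutative, so a product over the unordered
    set of cosets makes sense as a \<open>finprod\<close>.\<close>
  interpret H: comm_group "G\<lparr>carrier := C\<rparr>"
  proof (rule group.group_comm_groupI)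
    show "group (G\<lparr>carrier := C\<rparr>)" by (rule C.subgroup_is_group[OF is_group])
    fix x y assume "x \<in> carrier (G\<lparr>carrier := C\<rparr>)" "y \<in> carrier (G\<lparr>carrier := C\<rparr>)"
    then show "x \<otimes>\<^bsub>G\<lparr>carrier := C\<rparr>\<^esub> y = y \<otimes>\<^bsub>G\<lparr>carrier := C\<rparr>\<^esub> x"
      using central by (auto simp: grp_center_def)
  qed
  define V where "V g = finprod (G\<lparr>carrier := C\<rparr>) (\<lambda>u. c u g) (rcosets C)" for g
  have VC: "V g \<in> C" if "g \<in> carrier G" for g
    using H.finprod_closed[of "\<lambda>u. c u g" "rcosets C"] cC that unfolding V_def by auto
  have Vmul: "V (g \<otimes> h) = V g \<otimes> V h" if g: "g \<in> carrier G" and h: "h \<in> carrier G" for g h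
  proof -
    \<comment> \<open>Translation by \<open>g\<close> permutes the finitely many cosets; reindexing
      turns \<open>V h\<close> into the product of the factors \<open>c (u #> g) h\<close> coming
      from the cocycle identity.\<close>
    have inj: "inj_on (\<lambda>u. u #> g) (rcosets C)"
      by (rule inj_on_inverseI[where g = "\<lambda>u. u #> inv g"])
        (use g ugh in \<open>simp add: coset_mult_one C.rcosets_carrier[OF is_group]\<close>)
    have "(\<lambda>u. u #> g) ` (rcosets C) = rcosets C"
      using inj fin ug g by (intro endo_inj_surj) auto
    then have "V h = finprod (G\<lparr>carrier := C\<rparr>) (\<lambda>u. c (u #> g) h) (rcosets C)"
      using H.finprod_reindex[of "\<lambda>u. c u h" "\<lambda>u. u #> g" "rcosets C"] inj cC h
      unfolding V_def by auto
    moreover have "V (g \<otimes> h) = finprod (G\<lparr>carrier := C\<rparr>)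
        (\<lambda>u. c u g \<otimes>\<^bsub>G\<lparr>carrier := C\<rparr>\<^esub> c (u #> g) h) (rcosets C)"
      unfolding V_def by (rule H.finprod_cong') (use cmul cC ug g h in auto)
    ultimately show ?thesis
      using H.finprod_multf[of "\<lambda>u. c u g" "rcosets C" "\<lambda>u. c (u #> g) h"] cC ug g h
      unfolding V_def by auto
  qed
  have Vpow: "V g = g [^] card (rcosets C)" if g: "g \<in> C" for g
  proof -
    have gc: "g \<in> carrier G" using g C.subset by blast
    have "c u g = g" if u: "u \<in> rcosets C" for u
    proof -
      have comm: "s u \<otimes> g = g \<otimes> s u" using central g sc[OF u] by (auto simp: grp_center_def)
      have "u #> g = C #> (g \<otimes> s u)"
        using us[OF u] coset_mult_assoc[OF C.subset sc[OF u] gc] comm by simp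
      also have "\<dots> = u"
        using us[OF u] coset_mult_assoc[OF C.subset gc sc[OF u]] coset_join2[OF gc C g] by simp
      finally show ?thesis unfolding c_def comm using gc sc u by (simp add: m_assoc)
    qed
    then have "V g = finprod (G\<lparr>carrier := C\<rparr>) (\<lambda>u. g) (rcosets C)"
      unfolding V_def by (intro H.finprod_cong') (use g in auto)
    also have "\<dots> = g [^]\<^bsub>G\<lparr>carrier := C\<rparr>\<^esub> card (rcosets C)"
      by (rule H.finprod_const) (use g in simp)
    finally show ?thesis by (simp add: nat_pow_consistent[symmetric])
  qed
  have "C \<in> rcosets C" using C.subgroup_in_rcosets[OF is_group] .
  then have "card (rcosets C) > 0" using fin by (auto simp: card_gt_0_iff)
  moreover have "V \<in> hom G G" using VC Vmul C.subset by (auto simp: hom_def)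
  ultimately show ?thesis using that VC Vpow by blast
qed

text \<open>Lagrange in \<open>G Mod C\<close>: the order of the quotient kills the coset of
  \<open>x\<close>.\<close>

lemma finite_rcosets_pow_mem:
  assumes C: "C \<lhd> G" and fin: "finite (rcosets C)" and x: "x \<in> carrier G"
  shows "x [^] card (rcosets C) \<in> C"
proof -
  interpret C: normal C G by (rule C)
  interpret Q: group "G Mod C" by (rule C.factorgroup_is_group)
  have "(C #> x) [^]\<^bsub>G Mod C\<^esub> order (G Mod C) = \<one>\<^bsub>G Mod C\<^esub>"
    by (rule Q.pow_order_eq_1) (use x in \<open>auto simp: carrier_FactGroup\<close>)
  then have "C #> (x [^] card (rcosets C)) = C"
    using C.FactGroup_pow[OF x] by (simp add: order_def FactGroup_def)
  then show ?thesis using x C.subgroup_axioms by (meson coset_join1 nat_pow_closed)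
qed

lemma central_imp_normal:
  assumes "subgroup C G" "C \<subseteq> grp_center G"
  shows "C \<lhd> G"
  unfolding normal_inv_iff
proof (intro conjI ballI)
  fix x h assume "x \<in> carrier G" "h \<in> C"
  then have hc: "h \<in> carrier G" and "h \<otimes> x = x \<otimes> h"
    using assms by (auto simp: grp_center_def)
  then have "x \<otimes> h \<otimes> inv x = h"
    using \<open>x \<in> carrier G\<close> by (metis inv_solve_right m_closed)
  then show "x \<otimes> h \<otimes> inv x \<in> C" using \<open>h \<in> C\<close> by simp
qed (use assms in simp)

lemma torsion_inv:
  assumes "x \<in> carrier G" "torsion G x"
  shows "torsion G (inv x)"
  using assms by (auto simp: torsion_def nat_pow_inv)

lemma torsion_commuting_mult:
  assumes x: "x \<in> carrier G" "torsion G x" and y: "y \<in> carrier G" "torsion G y" and xy: "x \<otimes> y = y \<otimes> x"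
  shows "torsion G (x \<otimes> y)"
proof -
  obtain m n :: nat where mn: "m > 0" "n > 0" "x [^] m = \<one>" "y [^] n = \<one>"
    using x y by (auto simp: torsion_def)
  have "(x \<otimes> y) [^] (m * n) = (x [^] m) [^] n \<otimes> (y [^] n) [^] m"
    using pow_mult_distrib[OF xy x(1) y(1)] x(1) y(1) by (simp add: nat_pow_pow mult.commute)
  also have "\<dots> = \<one>" using mn by simp
  finally show ?thesis using mn unfolding torsion_def by (intro exI[of _ "m * n"]) simp
qed

text \<open>The transfer \<open>V\<close> preserves and reflects torsion, and its values are
  central. Torsion questions about \<open>G\<close> thus move to commuting elements, where powers of
  products split.\<close>

lemma torsion_central_by_finite:
  assumes C: "subgroup C G" and central: "C \<subseteq> grp_center G" and fin: "finite (rcosets C)"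
  shows "subgroup {x \<in> carrier G. torsion G x} G"
    and "\<And>x y r. \<lbrakk>x \<in> carrier G; y \<in> carrier G; r > 0; x [^] (r::nat) = y [^] r\<rbrakk> \<Longrightarrow> torsion G (x \<otimes> inv y)"
proof -
  obtain V N where V: "V \<in> hom G G" "V ` carrier G \<subseteq> C" and N: "N > (0::nat)"
    and VN: "\<And>c. c \<in> C \<Longrightarrow> V c = c [^] N"
    using central_transfer[OF assms] by metis
  interpret V: group_hom G G V using V by unfold_locales
  have comm: "V x \<otimes> V y = V y \<otimes> V x" if "x \<in> carrier G" "y \<in> carrier G" for x y
  proof -
    have "V x \<in> grp_center G" using V(2) central that by blast
    then show ?thesis using that by (simp add: grp_center_def)
  qed
  define q where "q = card (rcosets C)"
  have q: "q > 0" unfolding q_def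
    using subgroup.subgroup_in_rcosets[OF C is_group] fin by (auto simp: card_gt_0_iff)
  \<comment> \<open>With \<open>q\<close> the index, \<open>x [^] q\<close> lies in
    \<open>C\<close>, where \<open>V\<close> is the \<open>N\<close>-th power map. Hence
    \<open>V x [^] q = x [^] (q * N)\<close>, and a torsion value forces \<open>x\<close> to be
    torsion.\<close>
  have backward: "torsion G x" if x: "x \<in> carrier G" and t: "torsion G (V x)" for x
  proof -
    obtain n where n: "n > 0" "V x [^] (n::nat) = \<one>" using t by (auto simp: torsion_def)
    have "x [^] q \<in> C" unfolding q_def
      by (rule finite_rcosets_pow_mem[OF central_imp_normal[OF C central] fin x])
    from VN[OF this] have "V x [^] q = x [^] (q * N)" using x by (simp add: V.hom_nat_pow nat_pow_pow)
    then have "x [^] (q * N * n) = (V x [^] q) [^] n" using x by (simp only: nat_pow_pow)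
    also have "\<dots> = (V x [^] n) [^] q" using x by (simp add: nat_pow_pow mult.commute)
    also have "\<dots> = \<one>" using n by simp
    finally show ?thesis using n q N unfolding torsion_def by (intro exI[of _ "q * N * n"]) simp
  qed
  have forward: "torsion G (V x)" if "x \<in> carrier G" "torsion G x" for x
    using that V.hom_nat_pow V.hom_one unfolding torsion_def by metis
  show "subgroup {x \<in> carrier G. torsion G x} G"
  proof (rule subgroupI)
    show "{x \<in> carrier G. torsion G x} \<noteq> {}"
      by (auto intro!: exI[of _ "\<one>"] simp: torsion_def)
  next
    fix x y assume "x \<in> {x \<in> carrier G. torsion G x}" "y \<in> {x \<in> carrier G. torsion G x}"
    then show "x \<otimes> y \<in> {x \<in> carrier G. torsion G x}"
      using backward[of "x \<otimes> y"] torsion_commuting_mult[of "V x" "V y"] comm forward by auto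
  qed (auto intro: torsion_inv)
  fix x y and r :: nat
  assume x: "x \<in> carrier G" and y: "y \<in> carrier G" and r: "r > 0" and e: "x [^] r = y [^] r"
  \<comment> \<open>\<open>x\<close> and \<open>y\<close> need not commute, but their transfers do,
    so the \<open>r\<close>-th power splits.\<close>
  have "(V x \<otimes> V (inv y)) [^] r = V x [^] r \<otimes> V (inv y) [^] r"
    by (intro pow_mult_distrib comm V.hom_closed inv_closed x y)
  also have "\<dots> = V (x [^] r) \<otimes> inv V (y [^] r)"
    using x y by (simp add: V.hom_nat_pow nat_pow_inv)
  also have "\<dots> = \<one>" using e x y by simp
  finally have "torsion G (V (x \<otimes> inv y))" using r x y by (auto simp: torsion_def)
  then show "torsion G (x \<otimes> inv y)" using backward x y by simp
qed

end

text \<open>A series with cyclic or finite factors, each term normal in the whole group. Covering a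
  term by products of the previous term with powers of one element, or with a finite set, avoids
  quotient groups and carries over directly to homomorphic images.\<close>

definition virtually_polycyclic :: "('a, 'b) monoid_scheme \<Rightarrow> bool" where
  "virtually_polycyclic G \<longleftrightarrow> (\<exists>H m. H 0 = {\<one>\<^bsub>G\<^esub>} \<and> H m = carrier G \<and>
     (\<forall>i\<le>m. H i \<lhd> G) \<and>
     (\<forall>i<m. (\<exists>g\<in>carrier G. H (Suc i) \<subseteq> {h \<otimes>\<^bsub>G\<^esub> g [^]\<^bsub>G\<^esub> (k::int) | h k. h \<in> H i}) \<or>
       (\<exists>F\<subseteq>carrier G. finite F \<and> H (Suc i) \<subseteq> H i <#>\<^bsub>G\<^esub> F)))"

context group
begin

text \<open>Two elements of \<open>Q\<close> in one right coset of \<open>H\<close> differ by an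
  element of \<open>P \<inter> H\<close>, so each of the finitely many cosets \<open>H #> f\<close>
  meets \<open>Q\<close> in a finite set.\<close>

lemma finite_periodic_extension:
  assumes P: "subgroup P G" and H: "subgroup H G" and fin: "finite (P \<inter> H)"
    and F: "finite F" "F \<subseteq> carrier G" and Q: "Q \<subseteq> P" "Q \<subseteq> H <#> F"
  shows "finite Q"
proof -
  have "finite (Q \<inter> (H #> f))" if f: "f \<in> F" for f
  proof (cases "Q \<inter> (H #> f) = {}")
    case False
    then obtain q where q: "q \<in> Q" "q \<in> H #> f" by auto
    have fc: "f \<in> carrier G" using f F by auto
    have qc: "q \<in> carrier G" using q Q subgroup.mem_carrier[OF P] by auto
    have "Q \<inter> (H #> f) \<subseteq> (\<lambda>h. h \<otimes> q) ` (P \<inter> H)"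
    proof
      fix p assume p: "p \<in> Q \<inter> (H #> f)"
      have pc: "p \<in> carrier G" using p Q subgroup.mem_carrier[OF P] by auto
      have "p \<otimes> inv q \<in> P" using p q Q(1) P
        by (intro subgroup.m_closed subgroup.m_inv_closed) auto
      moreover have "H #> f = H #> q" by (rule repr_independence[OF q(2) fc H])
      then have "p \<otimes> inv q \<in> H"
        using p subgroup.rcos_module_imp[OF H is_group qc] by auto
      moreover have "p = p \<otimes> inv q \<otimes> q" using pc qc by (simp add: m_assoc)
      ultimately show "p \<in> (\<lambda>h. h \<otimes> q) ` (P \<inter> H)" by blast
    qed
    then show ?thesis using fin finite_surj by blast
  qed simp
  with F have "finite (\<Union>f\<in>F. Q \<inter> (H #> f))" by blast
  moreover have "Q \<subseteq> (\<Union>f\<in>F. Q \<inter> (H #> f))"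
    using Q(2) by (fastforce simp: set_mult_def r_coset_def)
  ultimately show ?thesis by (rule finite_subset[rotated])
qed

text \<open>Induction along the series on \<open>P \<inter> H i\<close>. A finite factor is handled
  by \<open>finite_periodic_extension\<close>. For a cyclic factor, either the generator has finite
  order modulo \<open>H i\<close> and the factor is finite as well, or torsion elements cannot leave
  \<open>H i\<close>.\<close>

lemma virtually_polycyclic_periodic_finite:
  assumes G: "virtually_polycyclic G" and P: "subgroup P G" and per: "\<And>x. x \<in> P \<Longrightarrow> torsion G x"
  shows "finite P"
proof -
  obtain H m where H0: "H 0 = {\<one>}" and Hm: "H m = carrier G" and nor: "\<And>i. i \<le> m \<Longrightarrow> H i \<lhd> G"
    and step: "\<And>i. i < m \<Longrightarrow> (\<exists>g\<in>carrier G. H (Suc i) \<subseteq> {h \<otimes> g [^] (k::int) | h k. h \<in> H i}) \<or>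
       (\<exists>F\<subseteq>carrier G. finite F \<and> H (Suc i) \<subseteq> H i <#> F)"
    using G unfolding virtually_polycyclic_def by blast
  have "finite (P \<inter> H i)" if "i \<le> m" for i
    using that
  proof (induction i)
    case 0
    then show ?case by (simp add: H0)
  next
    case (Suc i)
    then have IH: "finite (P \<inter> H i)" and im: "i < m" by auto
    interpret N: normal "H i" G using nor im by simp
    interpret Q: group "G Mod H i" by (rule N.factorgroup_is_group)
    have ext: ?case if "finite F" "F \<subseteq> carrier G" "P \<inter> H (Suc i) \<subseteq> H i <#> F" for F
      by (rule finite_periodic_extension[OF P N.subgroup_axioms IH that(1,2) _ that(3)]) auto
    consider (cyc) g where "g \<in> carrier G" "H (Suc i) \<subseteq> {h \<otimes> g [^] (k::int) | h k. h \<in> H i}"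
      | (fin) F where "F \<subseteq> carrier G" "finite F" "H (Suc i) \<subseteq> H i <#> F"
      using step[OF im] by blast
    then show ?case
    proof cases
      case fin
      then show ?thesis using ext by blast
    next
      case cyc
      have coset: "H i #> g [^] k = (H i #> g) [^]\<^bsub>G Mod H i\<^esub> k" for k :: int
        using N.FactGroup_int_pow[OF cyc(1)] by simp
      have gQ: "H i #> g \<in> carrier (G Mod H i)" using cyc(1) by (auto simp: carrier_FactGroup)
      show ?thesis
      proof (cases "\<exists>r>0. g [^] (r::int) \<in> H i")
        case True
        then obtain r where r: "r > 0" "g [^] (r::int) \<in> H i" by auto
        \<comment> \<open>Division of the exponent by \<open>r\<close> with remainder leaves only
          the representatives with exponents from \<open>0\<close> to \<open>r - 1\<close>.\<close>
        have "P \<inter> H (Suc i) \<subseteq> H i <#> (\<lambda>k. g [^] k) ` {0..<r}"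
        proof
          fix p assume p: "p \<in> P \<inter> H (Suc i)"
          then obtain h k where hk: "h \<in> H i" "p = h \<otimes> g [^] (k::int)" using cyc by auto
          have "g [^] k = g [^] (r * (k div r) + k mod r)" by simp
          also have "\<dots> = (g [^] r) [^] (k div r) \<otimes> g [^] (k mod r)"
            using cyc(1) by (simp only: int_pow_mult int_pow_pow)
          finally have "p = (h \<otimes> (g [^] r) [^] (k div r)) \<otimes> g [^] (k mod r)"
            using hk cyc(1) by (simp add: m_assoc)
          moreover have "h \<otimes> (g [^] r) [^] (k div r) \<in> H i"
            using hk r subgroup_int_pow_closed[OF N.subgroup_axioms] by auto
          moreover have "g [^] (k mod r) \<in> (\<lambda>k. g [^] k) ` {0..<r}" using r by simp
          ultimately show "p \<in> H i <#> (\<lambda>k. g [^] k) ` {0..<r}"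
            unfolding set_mult_def by blast
        qed
        then show ?thesis using ext[of "(\<lambda>k. g [^] k) ` {0..<r}"] cyc(1) by auto
      next
        case False
        \<comment> \<open>Modulo \<open>H i\<close> the elements \<open>p\<close> and
          \<open>g [^] k\<close> agree, so \<open>p [^] s = \<one>\<close> puts
          \<open>g [^] (k * int s)\<close> into \<open>H i\<close>, which forces
          \<open>k = 0\<close>.\<close>
        have "P \<inter> H (Suc i) \<subseteq> P \<inter> H i"
        proof
          fix p assume p: "p \<in> P \<inter> H (Suc i)"
          then obtain h k where hk: "h \<in> H i" "p = h \<otimes> g [^] (k::int)" using cyc by auto
          obtain s where s: "s > 0" "p [^] (s::nat) = \<one>" using per p by (auto simp: torsion_def)
          have pc: "p \<in> carrier G" using p P subgroup.mem_carrier by fastforce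
          have "p \<in> H i #> g [^] k" using hk by (auto simp: r_coset_def)
          then have "H i #> p = H i #> g [^] k"
            using repr_independence[OF _ _ N.subgroup_axioms, of p "g [^] k"] cyc(1) by simp
          then have "H i #> p [^] (int s) = H i #> g [^] (k * int s)"
            using N.FactGroup_int_pow[OF pc, of "int s"] gQ cyc(1)
            by (simp add: coset Q.int_pow_pow)
          then have "H i #> g [^] (k * int s) = H i"
            using s pc N.subset by (simp add: int_pow_int)
          then have g: "g [^] (k * int s) \<in> H i"
            using cyc(1) N.subgroup_axioms by (meson coset_join1 int_pow_closed)
          \<comment> \<open>The case assumption excludes only positive exponents; passing to the
            inverse excludes negative \<open>k\<close> too.\<close>
          then have "g [^] (- (k * int s)) \<in> H i" using cyc(1) by (simp add: int_pow_neg)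
          with g False have "\<not> k * int s > 0" "\<not> - (k * int s) > 0" by blast+
          then have "k = 0" using s by (simp add: zero_less_mult_iff mult_less_0_iff)
          then have "p = h" using hk by simp
          with p hk show "p \<in> P \<inter> H i" by simp
        qed
        then show ?thesis using IH finite_subset by blast
      qed
    qed
  qed
  from this[of m] show ?thesis
    using Hm subgroup.subset[OF P] by (simp add: Int_absorb2)
qed

end

text \<open>Needed because \<open>finite_bracket\<close> is applied in the quotients of
  \<open>B\<close> by the terms of \<open>upper_zeta\<close>. The map is applied term by term;
  surjectivity keeps the images normal.\<close>

lemma virtually_polycyclic_image:
  assumes G: "group G" and G': "group G'" and f: "f \<in> hom G G'" and surj: "f ` carrier G = carrier G'"
    and vp: "virtually_polycyclic G"
  shows "virtually_polycyclic G'"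
proof -
  interpret f: group_hom G G' f using G G' f by (simp add: group_hom_def group_hom_axioms_def)
  obtain H m where H0: "H 0 = {\<one>\<^bsub>G\<^esub>}" and Hm: "H m = carrier G" and nor: "\<And>i. i \<le> m \<Longrightarrow> H i \<lhd> G"
    and step: "\<And>i. i < m \<Longrightarrow> (\<exists>g\<in>carrier G. H (Suc i) \<subseteq> {h \<otimes>\<^bsub>G\<^esub> g [^]\<^bsub>G\<^esub> (k::int) | h k. h \<in> H i}) \<or>
       (\<exists>F\<subseteq>carrier G. finite F \<and> H (Suc i) \<subseteq> H i <#>\<^bsub>G\<^esub> F)"
    using vp unfolding virtually_polycyclic_def by blast
  have Hc: "H i \<subseteq> carrier G" if "i \<le> m" for i
    using nor[OF that] normal_imp_subgroup subgroup.subset by blast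
  have "f ` H i \<lhd> G'" if "i \<le> m" for i
    unfolding f.H.normal_inv_iff
  proof (intro conjI ballI)
    show "subgroup (f ` H i) G'"
      by (rule f.subgroup_img_is_subgroup[OF normal_imp_subgroup[OF nor[OF that]]])
  next
    fix x h assume "x \<in> carrier G'" "h \<in> f ` H i"
    moreover from \<open>x \<in> carrier G'\<close> obtain x' where "x' \<in> carrier G" "x = f x'" using surj by blast
    moreover from \<open>h \<in> f ` H i\<close> obtain h' where "h' \<in> H i" "h = f h'" by blast
    moreover have "x' \<otimes>\<^bsub>G\<^esub> h' \<otimes>\<^bsub>G\<^esub> inv\<^bsub>G\<^esub> x' \<in> H i"
      using \<open>x' \<in> carrier G\<close> \<open>h' \<in> H i\<close> normal.inv_op_closed2[OF nor[OF that]] by blast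
    moreover have "h' \<in> carrier G" using Hc that \<open>h' \<in> H i\<close> by blast
    ultimately have "x \<otimes>\<^bsub>G'\<^esub> h \<otimes>\<^bsub>G'\<^esub> inv\<^bsub>G'\<^esub> x = f (x' \<otimes>\<^bsub>G\<^esub> h' \<otimes>\<^bsub>G\<^esub> inv\<^bsub>G\<^esub> x')" by simp
    then show "x \<otimes>\<^bsub>G'\<^esub> h \<otimes>\<^bsub>G'\<^esub> inv\<^bsub>G'\<^esub> x \<in> f ` H i"
      using \<open>x' \<otimes>\<^bsub>G\<^esub> h' \<otimes>\<^bsub>G\<^esub> inv\<^bsub>G\<^esub> x' \<in> H i\<close> by blast
  qed
  moreover have "(\<exists>g\<in>carrier G'. f ` H (Suc i) \<subseteq> {h \<otimes>\<^bsub>G'\<^esub> g [^]\<^bsub>G'\<^esub> (k::int) | h k. h \<in> f ` H i}) \<or>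
       (\<exists>F\<subseteq>carrier G'. finite F \<and> f ` H (Suc i) \<subseteq> f ` H i <#>\<^bsub>G'\<^esub> F)" if i: "i < m" for i
    using step[OF i]
  proof (elim disjE bexE exE conjE)
    fix g assume g: "g \<in> carrier G" "H (Suc i) \<subseteq> {h \<otimes>\<^bsub>G\<^esub> g [^]\<^bsub>G\<^esub> (k::int) | h k. h \<in> H i}"
    have "f ` H (Suc i) \<subseteq> {h \<otimes>\<^bsub>G'\<^esub> f g [^]\<^bsub>G'\<^esub> (k::int) | h k. h \<in> f ` H i}"
    proof
      fix y assume "y \<in> f ` H (Suc i)"
      then obtain h k where "h \<in> H i" "y = f (h \<otimes>\<^bsub>G\<^esub> g [^]\<^bsub>G\<^esub> (k::int))" using g(2) by blast
      moreover have "h \<in> carrier G" using Hc[of i] i \<open>h \<in> H i\<close> by auto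
      ultimately show "y \<in> {h \<otimes>\<^bsub>G'\<^esub> f g [^]\<^bsub>G'\<^esub> (k::int) | h k. h \<in> f ` H i}"
        using g(1) \<open>h \<in> H i\<close> f.hom_int_pow[OF g(1)] by fastforce
    qed
    then show ?thesis by (intro disjI1 bexI[where x = "f g"] f.hom_closed g(1))
  next
    fix F assume F: "F \<subseteq> carrier G" "finite F" "H (Suc i) \<subseteq> H i <#>\<^bsub>G\<^esub> F"
    have "f ` (H i <#>\<^bsub>G\<^esub> F) = f ` H i <#>\<^bsub>G'\<^esub> f ` F"
      using set_mult_hom[OF f Hc F(1)] i by simp
    then have "f ` H (Suc i) \<subseteq> f ` H i <#>\<^bsub>G'\<^esub> f ` F" using F(3) by blast
    moreover have "f ` F \<subseteq> carrier G'" "finite (f ` F)" using F by auto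
    ultimately show ?thesis by (intro disjI2 exI[where x = "f ` F"] conjI)
  qed
  moreover have "f ` H 0 = {\<one>\<^bsub>G'\<^esub>}" by (simp add: H0)
  moreover have "f ` H m = carrier G'" by (simp add: Hm surj)
  ultimately show ?thesis
    unfolding virtually_polycyclic_def by (intro exI[of _ "\<lambda>i. f ` H i"] exI[of _ m] conjI allI impI)
qed

section \<open>Skew braces\<close>

lemma addG_simps [simp]:
  "carrier (addG B) = bcar B" "x \<otimes>\<^bsub>addG B\<^esub> y = badd B x y" "\<one>\<^bsub>addG B\<^esub> = bzero B" "inv\<^bsub>addG B\<^esub> x = bneg B x"
  by (simp_all add: addG_def bneg_def)

lemma mulG_simps [simp]:
  "carrier (mulG B) = bcar B" "x \<otimes>\<^bsub>mulG B\<^esub> y = bmul B x y" "\<one>\<^bsub>mulG B\<^esub> = bone B"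
  by (simp_all add: mulG_def)

locale skew_brace =
  fixes B :: "'a brace"
  assumes brace: "is_brace B"
begin

abbreviation add (infixl "\<boxplus>" 65) where "x \<boxplus> y \<equiv> badd B x y"
abbreviation mul (infixl "\<boxdot>" 70) where "x \<boxdot> y \<equiv> bmul B x y"
abbreviation neg ("\<boxminus> _" [81] 80) where "\<boxminus> x \<equiv> bneg B x"
abbreviation zero ("\<^bold>0") where "\<^bold>0 \<equiv> bzero B"
abbreviation star (infixl "\<star>" 72) where "x \<star> y \<equiv> bstar B x y"
abbreviation lam ("\<Lambda>") where "\<Lambda> \<equiv> blambda B"

sublocale A: group "addG B" using brace by (simp add: is_brace_def)
sublocale M: group "mulG B" using brace by (simp add: is_brace_def)

lemmas add_closed [simp] = A.m_closed[unfolded addG_simps]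
lemmas mul_closed [simp] = M.m_closed[unfolded mulG_simps]
lemmas neg_closed [simp] = A.inv_closed[unfolded addG_simps]
lemmas zero_closed [simp] = A.one_closed[unfolded addG_simps]
lemmas add_assoc = A.m_assoc[unfolded addG_simps]
lemmas mul_assoc = M.m_assoc[unfolded mulG_simps]
lemmas add_zero [simp] = A.l_one[unfolded addG_simps] A.r_one[unfolded addG_simps]
lemmas add_neg [simp] = A.l_inv[unfolded addG_simps] A.r_inv[unfolded addG_simps]
lemmas add_neg_cancel [simp] = A.inv_cancel_left[unfolded addG_simps]
lemmas neg_add = A.inv_mult_group[unfolded addG_simps]
lemmas neg_neg [simp] = A.inv_inv[unfolded addG_simps]
lemmas neg_zero [simp] = A.inv_one[unfolded addG_simps]

lemma mul_add:
  assumes "x \<in> bcar B" "y \<in> bcar B" "z \<in> bcar B"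
  shows "x \<boxdot> (y \<boxplus> z) = x \<boxdot> y \<boxplus> \<boxminus> x \<boxplus> x \<boxdot> z"
proof -
  have "\<forall>a\<in>bcar B. \<forall>b\<in>bcar B. \<forall>c\<in>bcar B. a \<boxdot> (b \<boxplus> c) = a \<boxdot> b \<boxplus> \<boxminus> a \<boxplus> a \<boxdot> c"
    using brace unfolding is_brace_def by (elim conjE)
  from bspec[OF bspec[OF bspec[OF this assms(1)] assms(2)] assms(3)] show ?thesis .
qed

text \<open>Distributivity with \<open>a\<close> the multiplicative identity \<open>1\<close> and
  \<open>b = c = 0\<close> reads \<open>0 = 0 - 1 + 0\<close>.\<close>

lemma bone_eq: "bone B = \<^bold>0"
proof -
  have e: "bone B \<in> bcar B" using M.one_closed by simp
  have l: "bone B \<boxdot> \<^bold>0 = \<^bold>0" by (rule M.l_one[unfolded mulG_simps, OF zero_closed])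
  from mul_add[OF e zero_closed zero_closed]
  have "\<^bold>0 = \<boxminus> bone B" by (metis l add_zero zero_closed neg_closed e)
  then show ?thesis by (metis neg_neg[OF e] neg_zero)
qed

lemma mul_zero [simp]: "x \<in> bcar B \<Longrightarrow> \<^bold>0 \<boxdot> x = x" "x \<in> bcar B \<Longrightarrow> x \<boxdot> \<^bold>0 = x"
  by (rule M.l_one[unfolded mulG_simps bone_eq] M.r_one[unfolded mulG_simps bone_eq], assumption)+

lemma lam_closed [simp]: "x \<in> bcar B \<Longrightarrow> y \<in> bcar B \<Longrightarrow> \<Lambda> x y \<in> bcar B"
  by (simp add: blambda_def)
lemma star_closed [simp]: "x \<in> bcar B \<Longrightarrow> y \<in> bcar B \<Longrightarrow> x \<star> y \<in> bcar B"
  by (simp add: bstar_def)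
lemma lam_eq: "x \<in> bcar B \<Longrightarrow> y \<in> bcar B \<Longrightarrow> \<Lambda> x y = x \<star> y \<boxplus> y"
  by (simp add: bstar_def blambda_def add_assoc)
lemma star_eq: "x \<in> bcar B \<Longrightarrow> y \<in> bcar B \<Longrightarrow> x \<star> y = \<Lambda> x y \<boxplus> \<boxminus> y"
  by (simp add: bstar_def blambda_def)
lemma mul_eq: "x \<in> bcar B \<Longrightarrow> y \<in> bcar B \<Longrightarrow> x \<boxdot> y = x \<boxplus> \<Lambda> x y"
  by (simp add: blambda_def)

lemma lam_add: "x \<in> bcar B \<Longrightarrow> y \<in> bcar B \<Longrightarrow> z \<in> bcar B \<Longrightarrow> \<Lambda> x (y \<boxplus> z) = \<Lambda> x y \<boxplus> \<Lambda> x z"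
  by (simp add: blambda_def add_assoc mul_add)

lemma lam_hom: "x \<in> bcar B \<Longrightarrow> \<Lambda> x \<in> hom (addG B) (addG B)"
  by (simp add: hom_def lam_add Pi_iff)

lemma lam_group_hom: "x \<in> bcar B \<Longrightarrow> group_hom (addG B) (addG B) (\<Lambda> x)"
  by (unfold_locales) (rule lam_hom)

lemma lam_neg: "x \<in> bcar B \<Longrightarrow> y \<in> bcar B \<Longrightarrow> \<Lambda> x (\<boxminus> y) = \<boxminus> \<Lambda> x y"
  by (rule group_hom.hom_inv[OF lam_group_hom, unfolded addG_simps])

text \<open>Apply the additive map \<open>\<Lambda> x\<close> to
  \<open>\<boxminus> y \<boxplus> y \<boxdot> z\<close>; the two occurrences of \<open>x\<close>
  cancel.\<close>

lemma lam_mul: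
  assumes "x \<in> bcar B" "y \<in> bcar B" "z \<in> bcar B"
  shows "\<Lambda> (x \<boxdot> y) z = \<Lambda> x (\<Lambda> y z)"
proof -
  have "\<Lambda> x (\<Lambda> y z) = \<boxminus> \<Lambda> x y \<boxplus> \<Lambda> x (y \<boxdot> z)"
    using assms by (simp add: blambda_def[of B y] lam_add lam_neg)
  also have "\<dots> = \<Lambda> (x \<boxdot> y) z"
    using assms by (simp add: blambda_def add_assoc neg_add mul_assoc)
  finally show ?thesis by simp
qed

lemma lam_zero [simp]: "x \<in> bcar B \<Longrightarrow> \<Lambda> \<^bold>0 x = x"
  by (simp add: blambda_def)

lemma zero_star [simp]: "x \<in> bcar B \<Longrightarrow> \<^bold>0 \<star> x = \<^bold>0"
  by (simp add: star_eq)

text \<open>Comes from \<open>lam_mul\<close> on writing \<open>\<Lambda> x w\<close> as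
  \<open>x \<star> w \<boxplus> w\<close>. Up to the term \<open>x \<star> (y \<star> z)\<close>,
  starring with \<open>z\<close> turns products into sums, which drives the treatment of
  \<open>k \<star> b\<close> in \<open>finite_bracket\<close>.\<close>

lemma mul_star:
  assumes "x \<in> bcar B" "y \<in> bcar B" "z \<in> bcar B"
  shows "(x \<boxdot> y) \<star> z = x \<star> (y \<star> z) \<boxplus> y \<star> z \<boxplus> x \<star> z"
proof -
  have "(x \<boxdot> y) \<star> z = \<Lambda> x (y \<star> z \<boxplus> z) \<boxplus> \<boxminus> z"
    using assms by (simp add: star_eq[of "x \<boxdot> y"] lam_mul lam_eq[of y])
  also have "\<dots> = x \<star> (y \<star> z) \<boxplus> y \<star> z \<boxplus> (x \<star> z \<boxplus> z) \<boxplus> \<boxminus> z"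
    using assms by (simp only: lam_add star_closed lam_eq)
  finally show ?thesis using assms by (simp add: add_assoc)
qed

section \<open>The centre of a brace and its ideals\<close>

lemma bzeta_iff:
  "z \<in> bzeta B \<longleftrightarrow> z \<in> bcar B \<and> (\<forall>b\<in>bcar B. \<Lambda> z b = b \<and> z \<boxplus> b = b \<boxplus> z \<and> z \<boxdot> b = b \<boxdot> z)"
  by (auto simp: bzeta_def Soc_def ker_lambda_def grp_center_def)

lemma bzetaD:
  assumes "z \<in> bzeta B" "b \<in> bcar B"
  shows "z \<in> bcar B" "\<Lambda> z b = b" "z \<boxplus> b = b \<boxplus> z" "z \<boxdot> b = z \<boxplus> b" "b \<boxdot> z = z \<boxplus> b" "\<Lambda> b z = z"
proof -
  show z: "z \<in> bcar B" "\<Lambda> z b = b" "z \<boxplus> b = b \<boxplus> z" using assms by (auto simp: bzeta_iff)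
  then show zb: "z \<boxdot> b = z \<boxplus> b" using assms(2) by (simp add: mul_eq)
  then show "b \<boxdot> z = z \<boxplus> b" using assms by (simp add: bzeta_iff)
  then show "\<Lambda> b z = z" using assms(2) z by (simp add: blambda_def)
qed

text \<open>Ideals described by additive normality and two-sided absorption under
  \<open>\<star>\<close>. Invariance under \<open>\<Lambda>\<close> follows at once, and normality
  in the multiplicative group is \<open>star_ideal_normal_mulG\<close>. This form is easy to verify
  for brackets, images and preimages.\<close>

definition "star_ideal I \<longleftrightarrow> I \<lhd> addG B \<and> (\<forall>b\<in>bcar B. \<forall>x\<in>I. b \<star> x \<in> I \<and> x \<star> b \<in> I)"

lemma star_idealD:
  assumes "star_ideal I"
  shows "I \<lhd> addG B" "subgroup I (addG B)"
    "\<^bold>0 \<in> I" "\<And>x. x \<in> I \<Longrightarrow> x \<in> bcar B" "\<And>x y. x \<in> I \<Longrightarrow> y \<in> I \<Longrightarrow> x \<boxplus> y \<in> I" "\<And>x. x \<in> I \<Longrightarrow> \<boxminus> x \<in> I"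
    "\<And>x b. x \<in> I \<Longrightarrow> b \<in> bcar B \<Longrightarrow> b \<star> x \<in> I" "\<And>x b. x \<in> I \<Longrightarrow> b \<in> bcar B \<Longrightarrow> x \<star> b \<in> I"
    "\<And>x b. x \<in> I \<Longrightarrow> b \<in> bcar B \<Longrightarrow> b \<boxplus> x \<boxplus> \<boxminus> b \<in> I" "\<And>x b. x \<in> I \<Longrightarrow> b \<in> bcar B \<Longrightarrow> \<boxminus> b \<boxplus> x \<boxplus> b \<in> I"
    "\<And>x b. x \<in> I \<Longrightarrow> b \<in> bcar B \<Longrightarrow> \<Lambda> b x \<in> I" "\<And>x y. x \<in> I \<Longrightarrow> y \<in> I \<Longrightarrow> x \<boxdot> y \<in> I"
proof -
  show n: "I \<lhd> addG B" using assms by (simp add: star_ideal_def)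
  then show s: "subgroup I (addG B)" by (rule normal_imp_subgroup)
  show "\<^bold>0 \<in> I" using subgroup.one_closed[OF s] by simp
  show c: "x \<in> bcar B" if "x \<in> I" for x using subgroup.mem_carrier[OF s that] by simp
  show a: "x \<boxplus> y \<in> I" if "x \<in> I" "y \<in> I" for x y using subgroup.m_closed[OF s that] by simp
  show "\<boxminus> x \<in> I" if "x \<in> I" for x using subgroup.m_inv_closed[OF s that] by simp
  show st: "b \<star> x \<in> I" "x \<star> b \<in> I" if "x \<in> I" "b \<in> bcar B" for x b using assms that by (auto simp: star_ideal_def)
  show "b \<boxplus> x \<boxplus> \<boxminus> b \<in> I" if "x \<in> I" "b \<in> bcar B" for x b using normal.inv_op_closed2[OF n, of b x] that by simp
  show "\<boxminus> b \<boxplus> x \<boxplus> b \<in> I" if "x \<in> I" "b \<in> bcar B" for x b using normal.inv_op_closed1[OF n, of b x] that by simp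
  show l: "\<Lambda> b x \<in> I" if "x \<in> I" "b \<in> bcar B" for x b using a st that c by (simp add: lam_eq)
  show "x \<boxdot> y \<in> I" if "x \<in> I" "y \<in> I" for x y using a l that c by (simp add: mul_eq)
qed

lemma star_ideal_carrier: "star_ideal (bcar B)"
proof -
  have "bcar B \<lhd> addG B"
    using A.subgroup_self unfolding A.normal_inv_iff by simp
  then show ?thesis by (simp add: star_ideal_def)
qed

text \<open>Once \<open>\<Lambda> z b = b\<close> and \<open>z\<close> is additively central,
  \<open>z \<boxdot> b\<close> is \<open>z \<boxplus> b\<close> while \<open>b \<boxdot> z\<close>
  is \<open>b \<boxplus> \<Lambda> b z\<close>; commuting multiplicatively thus means
  \<open>\<Lambda> b z = z\<close>.\<close>

lemma bzeta_iff':
  "z \<in> bzeta B \<longleftrightarrow> z \<in> bcar B \<and> (\<forall>b\<in>bcar B. \<Lambda> z b = b \<and> \<Lambda> b z = z \<and> z \<boxplus> b = b \<boxplus> z)"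
proof
  assume z: "z \<in> bzeta B"
  then have "z \<in> bcar B" by (simp add: bzeta_iff)
  then show "z \<in> bcar B \<and> (\<forall>b\<in>bcar B. \<Lambda> z b = b \<and> \<Lambda> b z = z \<and> z \<boxplus> b = b \<boxplus> z)"
    using bzetaD(2,3,6)[OF z] by blast
next
  assume R: "z \<in> bcar B \<and> (\<forall>b\<in>bcar B. \<Lambda> z b = b \<and> \<Lambda> b z = z \<and> z \<boxplus> b = b \<boxplus> z)"
  then have "z \<boxdot> b = b \<boxdot> z" if "b \<in> bcar B" for b
    using that by (simp add: mul_eq)
  with R show "z \<in> bzeta B" unfolding bzeta_iff by blast
qed

lemma star_ideal_bzeta: "star_ideal (bzeta B)"
proof -
  have sub: "subgroup (bzeta B) (addG B)"
  proof (rule A.subgroupI)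
    show "bzeta B \<subseteq> carrier (addG B)" by (auto simp: bzeta_iff)
    have "\<Lambda> b \<^bold>0 = \<^bold>0" if "b \<in> bcar B" for b
      using group_hom.hom_one[OF lam_group_hom[OF that]] by simp
    then have "\<^bold>0 \<in> bzeta B" by (simp add: bzeta_iff')
    then show "bzeta B \<noteq> {}" by blast
  next
    fix z assume z: "z \<in> bzeta B"
    then have zc: "z \<in> bcar B" by (simp add: bzeta_iff')
    \<comment> \<open>For central \<open>z\<close> the additive inverse is also a multiplicative
      one, so \<open>\<Lambda> (\<boxminus> z)\<close> inverts the identity map
      \<open>\<Lambda> z\<close>.\<close>
    have "z \<boxdot> \<boxminus> z = \<^bold>0" using bzetaD(4)[OF z, of "\<boxminus> z"] zc by simp
    then have "\<Lambda> (\<boxminus> z) b = b" if "b \<in> bcar B" for b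
      using lam_mul[of z "\<boxminus> z" b] bzetaD(2)[OF z, of "\<Lambda> (\<boxminus> z) b"] zc that by simp
    moreover have "\<Lambda> b (\<boxminus> z) = \<boxminus> z" if "b \<in> bcar B" for b
      using lam_neg[OF that zc] bzetaD(6)[OF z that] by simp
    moreover have "\<boxminus> z \<boxplus> b = b \<boxplus> \<boxminus> z" if "b \<in> bcar B" for b
    proof -
      have "\<boxminus> z \<boxplus> b = \<boxminus> z \<boxplus> (b \<boxplus> z) \<boxplus> \<boxminus> z" using zc that by (simp add: add_assoc)
      also have "\<dots> = b \<boxplus> \<boxminus> z" using zc that by (simp flip: bzetaD(3)[OF z that])
      finally show ?thesis .
    qed
    ultimately show "inv\<^bsub>addG B\<^esub> z \<in> bzeta B" using zc by (simp add: bzeta_iff')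
  next
    fix z w assume z: "z \<in> bzeta B" and w: "w \<in> bzeta B"
    then have c: "z \<in> bcar B" "w \<in> bcar B" by (simp_all add: bzeta_iff')
    \<comment> \<open>Here \<open>z \<boxplus> w = z \<boxdot> w\<close>, so \<open>lam_mul\<close>
      applies.\<close>
    have "\<Lambda> (z \<boxplus> w) b = b" if "b \<in> bcar B" for b
      using lam_mul[of z w b] bzetaD(4)[OF z c(2)] bzetaD(2)[OF z that] bzetaD(2)[OF w that] c that by simp
    moreover have "\<Lambda> b (z \<boxplus> w) = z \<boxplus> w" if "b \<in> bcar B" for b
      using lam_add[OF that c] bzetaD(6)[OF z that] bzetaD(6)[OF w that] by simp
    moreover have "z \<boxplus> w \<boxplus> b = b \<boxplus> (z \<boxplus> w)" if "b \<in> bcar B" for b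
    proof -
      have "z \<boxplus> w \<boxplus> b = z \<boxplus> b \<boxplus> w" using c that bzetaD(3)[OF w that] by (simp add: add_assoc)
      then show ?thesis using c that bzetaD(3)[OF z that] by (simp add: add_assoc)
    qed
    ultimately show "z \<otimes>\<^bsub>addG B\<^esub> w \<in> bzeta B" using c by (simp add: bzeta_iff')
  qed
  have "bzeta B \<lhd> addG B"
    by (rule A.central_imp_normal[OF sub]) (auto simp: bzeta_def Soc_def)
  moreover have "b \<star> z = \<^bold>0" "z \<star> b = \<^bold>0" if "b \<in> bcar B" "z \<in> bzeta B" for b z
    using that bzetaD[OF that(2,1)] by (simp_all add: star_eq)
  moreover have "\<^bold>0 \<in> bzeta B" using subgroup.one_closed[OF sub] by simp
  ultimately show ?thesis by (simp add: star_ideal_def)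
qed

section \<open>One step of the lower central series, as an operator on subsets\<close>

definition bracket :: "'a set \<Rightarrow> 'a set" where
  "bracket K = generate (addG B) (bstar_set B K (bcar B) \<union> bstar_set B (bcar B) K
     \<union> {add_comm B x y | x y. x \<in> K \<and> y \<in> bcar B})"

lemma bracket_subset:
  assumes S: "subgroup S (addG B)"
    and "\<And>k b. k \<in> K \<Longrightarrow> b \<in> bcar B \<Longrightarrow> k \<star> b \<in> S \<and> b \<star> k \<in> S \<and> add_comm B k b \<in> S"
  shows "bracket K \<subseteq> S"
  unfolding bracket_def bstar_set_def
  by (intro A.generate_subgroup_incl[OF _ S] Un_least) (use assms(2) in auto)

lemma add_comm_closed [simp]: "x \<in> bcar B \<Longrightarrow> y \<in> bcar B \<Longrightarrow> add_comm B x y \<in> bcar B"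
  by (simp add: add_comm_def)

lemma bracket_gens:
  assumes "k \<in> K" "b \<in> bcar B"
  shows "k \<star> b \<in> bracket K" "b \<star> k \<in> bracket K" "add_comm B k b \<in> bracket K"
proof -
  have "k \<star> b \<in> bstar_set B K (bcar B)" "b \<star> k \<in> bstar_set B (bcar B) K"
    unfolding bstar_set_def by (rule generate.incl, use assms in blast)+
  then show "k \<star> b \<in> bracket K" "b \<star> k \<in> bracket K" "add_comm B k b \<in> bracket K"
    unfolding bracket_def using assms by (blast intro: generate.incl)+
qed

lemma subgroup_bracket:
  assumes K: "K \<subseteq> bcar B"
  shows "subgroup (bracket K) (addG B)"
  unfolding bracket_def bstar_set_def
proof (intro A.generate_is_subgroup Un_least)
  show "generate (addG B) {x \<star> y |x y. x \<in> K \<and> y \<in> bcar B} \<subseteq> carrier (addG B)"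
    by (intro A.generate_incl) (use K in \<open>auto dest: subsetD\<close>)
  show "generate (addG B) {x \<star> y |x y. x \<in> bcar B \<and> y \<in> K} \<subseteq> carrier (addG B)"
    by (intro A.generate_incl) (use K in \<open>auto dest: subsetD\<close>)
  show "{add_comm B x y |x y. x \<in> K \<and> y \<in> bcar B} \<subseteq> carrier (addG B)"
    using K by (auto dest: subsetD)
qed

text \<open>The bracket stays inside \<open>K\<close>, so stars of its elements with elements of
  \<open>B\<close> are again generators. Conjugating \<open>x\<close> by \<open>b\<close> adds the
  commutator of \<open>x\<close> with \<open>\<boxminus> b\<close>, also a generator.\<close>

lemma star_ideal_bracket:
  assumes K: "star_ideal K"
  shows "star_ideal (bracket K)"
proof -
  note Kd = star_idealD[OF K]
  have Kc: "K \<subseteq> bcar B" using Kd(4) by blast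
  have comm: "add_comm B k b \<in> K" if "k \<in> K" "b \<in> bcar B" for k b
  proof -
    have "add_comm B k b = \<boxminus> k \<boxplus> (\<boxminus> b \<boxplus> k \<boxplus> b)"
      using that Kd(4) by (simp add: add_comm_def add_assoc)
    then show ?thesis using that Kd by simp
  qed
  have sub: "bracket K \<subseteq> K" by (rule bracket_subset[OF Kd(2)]) (simp add: Kd(7,8) comm)
  have "b \<boxplus> x \<boxplus> \<boxminus> b \<in> bracket K" if x: "x \<in> bracket K" and b: "b \<in> bcar B" for x b
  proof -
    have xK: "x \<in> K" using sub x by blast
    then have "b \<boxplus> x \<boxplus> \<boxminus> b = x \<boxplus> add_comm B x (\<boxminus> b)"
      using b Kd(4) by (simp add: add_comm_def add_assoc)
    then show ?thesis
      using subgroup.m_closed[OF subgroup_bracket[OF Kc] x bracket_gens(3)[OF xK, of "\<boxminus> b"]] b by simp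
  qed
  then have "bracket K \<lhd> addG B" using subgroup_bracket[OF Kc] by (simp add: A.normal_inv_iff)
  then show ?thesis using bracket_gens(1,2) sub by (simp add: star_ideal_def subset_iff)
qed

lemma Gamma_Suc_Suc: "Gamma B (Suc (Suc k)) = bracket (Gamma B (Suc k))"
  by (simp add: bracket_def)

lemma star_ideal_Gamma: "star_ideal (Gamma B (Suc k))"
proof (induction k)
  case 0
  then show ?case by (simp add: star_ideal_carrier)
next
  case (Suc k)
  then show ?case unfolding Gamma_Suc_Suc by (rule star_ideal_bracket)
qed

subsection \<open>Finiteness modulo the centre\<close>

text \<open>\<open>F\<close> represents \<open>K\<close> modulo the centre. The transfer is used
  inside \<open>(K, +)\<close>, where \<open>K \<inter> bzeta B\<close> is central of finite index;
  all generators of the bracket are shown to lie in the finite torsion subgroup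
  \<open>T\<close>.\<close>

lemma finite_bracket:
  assumes vp: "virtually_polycyclic (addG B)" and K: "star_ideal K"
    and F: "finite F" "F \<subseteq> K" and KF: "\<And>k. k \<in> K \<Longrightarrow> \<exists>f\<in>F. \<exists>z\<in>bzeta B. k = z \<boxplus> f"
  shows "finite (bracket K)"
proof -
  note Kd = star_idealD[OF K]
  let ?H = "addG B\<lparr>carrier := K\<rparr>"
  interpret H: group ?H by (rule A.subgroup_imp_group[OF Kd(2)])
  interpret Z: subgroup "bzeta B" "addG B" by (rule star_idealD(2)[OF star_ideal_bzeta])
  define C where "C = K \<inter> bzeta B"
  have C: "subgroup C ?H"
    unfolding C_def using A.subgroups_Inter_pair[OF Kd(2) Z.subgroup_axioms] Kd(2)
    by (simp add: A.subgroup_incl)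
  have central: "C \<subseteq> grp_center ?H"
    using Kd(4) by (auto simp: C_def grp_center_def intro: bzetaD)
  have fin: "finite (rcosets\<^bsub>?H\<^esub> C)"
  proof (rule finite_subset)
    show "rcosets\<^bsub>?H\<^esub> C \<subseteq> (\<lambda>f. C #>\<^bsub>?H\<^esub> f) ` F"
    proof
      fix U assume "U \<in> rcosets\<^bsub>?H\<^esub> C"
      then obtain k where k: "k \<in> K" "U = C #>\<^bsub>?H\<^esub> k" by (auto simp: RCOSETS_def)
      obtain f z where fz: "f \<in> F" "z \<in> bzeta B" "k = z \<boxplus> f" using KF[OF k(1)] by blast
      then have "z = k \<boxplus> \<boxminus> f" using F Kd(4) bzetaD(1)[OF fz(2) zero_closed] by (auto simp: add_assoc)
      then have "z \<in> K" using Kd(5)[OF k(1) Kd(6)] fz(1) F by blast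
      then have "z \<in> C" using fz by (simp add: C_def)
      then have "k \<in> C #>\<^bsub>?H\<^esub> f" using fz by (auto simp: r_coset_def)
      then have "U = C #>\<^bsub>?H\<^esub> f" using H.repr_independence[OF _ _ C] k fz F by auto
      then show "U \<in> (\<lambda>f. C #>\<^bsub>?H\<^esub> f) ` F" using fz by blast
    qed
  qed (use F in simp)
  \<comment> \<open>The index \<open>r\<close> serves as a common exponent: the
    \<open>r\<close>-fold multiple of any element of \<open>K\<close> is central.\<close>
  define r where "r = card (rcosets\<^bsub>?H\<^esub> C)"
  have r: "r > 0" unfolding r_def
    using subgroup.subgroup_in_rcosets[OF C H.is_group] fin by (auto simp: card_gt_0_iff)
  have pow: "x [^]\<^bsub>?H\<^esub> n = x [^]\<^bsub>addG B\<^esub> n" for x and n :: nat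
    using A.nat_pow_consistent by metis
  have rC: "k [^]\<^bsub>addG B\<^esub> r \<in> C" if "k \<in> K" for k
    using H.finite_rcosets_pow_mem[OF H.central_imp_normal[OF C central] fin, of k] that
    by (simp add: r_def pow)
  have tor: "torsion ?H x \<longleftrightarrow> torsion (addG B) x" for x by (simp add: torsion_def pow)
  define T where "T = {x \<in> K. torsion (addG B) x}"
  have TH: "subgroup T ?H"
    using H.torsion_central_by_finite(1)[OF C central fin] by (simp add: T_def tor)
  have T: "subgroup T (addG B)" by (rule A.incl_subgroup[OF Kd(2) TH])
  have finT: "finite T"
    by (rule A.virtually_polycyclic_periodic_finite[OF vp T]) (simp add: T_def)
  have TK: "T \<subseteq> K" by (auto simp: T_def)
  \<comment> \<open>\<open>\<phi>\<close> fixes the central \<open>r\<close>-fold multiple of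
    \<open>k\<close>, so \<open>\<phi> k\<close> and \<open>k\<close> have equal
    \<open>r\<close>-fold multiples and differ by torsion. Below, \<open>\<phi>\<close> is
    \<open>\<Lambda> b\<close> or conjugation by \<open>b\<close>.\<close>
  have endo: "\<phi> k \<boxplus> \<boxminus> k \<in> T"
    if \<phi>: "\<phi> \<in> hom (addG B) (addG B)" and K\<phi>: "\<phi> k \<in> K" and triv: "\<And>z. z \<in> bzeta B \<Longrightarrow> \<phi> z = z" and k: "k \<in> K" for \<phi> k
  proof -
    interpret \<phi>: group_hom "addG B" "addG B" \<phi> by unfold_locales (rule \<phi>)
    have "\<phi> k [^]\<^bsub>addG B\<^esub> r = k [^]\<^bsub>addG B\<^esub> r"
      using \<phi>.hom_nat_pow[of k r] rC[OF k] k Kd(4) triv by (simp add: C_def)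
    then have "torsion ?H (\<phi> k \<otimes>\<^bsub>?H\<^esub> inv\<^bsub>?H\<^esub> k)"
      using H.torsion_central_by_finite(2)[OF C central fin, of "\<phi> k" k r] r k K\<phi> by (simp add: pow)
    then show ?thesis using k K\<phi> Kd A.m_inv_consistent[OF Kd(2) k] by (simp add: T_def tor)
  qed
  have BK: "b \<star> k \<in> T" if "k \<in> K" "b \<in> bcar B" for k b
    using endo[OF lam_hom, of b k] that Kd bzetaD(6) by (simp add: star_eq)
  have comm: "add_comm B k b \<in> T" if k: "k \<in> K" and b: "b \<in> bcar B" for k b
  proof -
    define \<phi> where "\<phi> x = \<boxminus> b \<boxplus> x \<boxplus> b" for x
    have "\<phi> \<in> hom (addG B) (addG B)" using b by (auto simp: \<phi>_def hom_def add_assoc)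
    moreover have "\<phi> z = z" if "z \<in> bzeta B" for z
      using bzetaD(1,3)[OF that b] b by (simp add: \<phi>_def add_assoc)
    \<comment> \<open>\<open>endo\<close> subtracts on the right, whereas the commutator
      \<open>\<boxminus> k \<boxplus> \<phi> k\<close> has \<open>\<boxminus> k\<close> on the left.
      Using \<open>\<boxminus> k\<close> and negating the result repairs the order.\<close>
    moreover have "\<phi> (\<boxminus> k) \<in> K" using k b Kd by (simp add: \<phi>_def)
    ultimately have "\<phi> (\<boxminus> k) \<boxplus> \<boxminus> (\<boxminus> k) \<in> T" using endo k Kd by blast
    then have "\<boxminus> (\<phi> (\<boxminus> k) \<boxplus> k) \<in> T" using subgroup.m_inv_closed[OF T] k Kd(4) by fastforce
    moreover have "\<boxminus> (\<phi> (\<boxminus> k) \<boxplus> k) = add_comm B k b"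
      using k b Kd(4) by (simp add: \<phi>_def add_comm_def neg_add add_assoc)
    ultimately show ?thesis by simp
  qed
  have KB: "k \<star> b \<in> T" if k: "k \<in> K" and b: "b \<in> bcar B" for k b
  proof -
    let ?x = "k \<star> b"
    let ?p = "\<lambda>j::nat. ?x [^]\<^bsub>addG B\<^esub> j"
    have kc: "k \<in> bcar B" and x: "?x \<in> K" and xc: "?x \<in> bcar B" using k b Kd by simp_all
    have pc: "?p j \<in> bcar B" for j using A.nat_pow_closed[of ?x j] xc by simp
    have Tc: "t \<in> bcar B" if "t \<in> T" for t using that TK Kd(4) by blast
    \<comment> \<open>Up to an element of \<open>T\<close>, each multiple of
      \<open>k \<star> b\<close> is again a star value \<open>l \<star> b\<close>. The induction
      replaces \<open>l\<close> by \<open>k \<boxdot> l\<close>; the extra term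
      \<open>k \<star> (l \<star> b)\<close> in \<open>mul_star\<close> lies in \<open>T\<close> by
      \<open>BK\<close>.\<close>
    have step: "\<exists>l\<in>K. \<exists>t\<in>T. l \<star> b = t \<boxplus> ?p j" for j
    proof (induction j)
      case 0
      have "\<^bold>0 \<in> T" using subgroup.one_closed[OF T] by simp
      then show ?case using Kd(3) b by (intro bexI[of _ "\<^bold>0"]) auto
    next
      case (Suc j)
      then obtain l t where l: "l \<in> K" and t: "t \<in> T" and e: "l \<star> b = t \<boxplus> ?p j" by blast
      have t': "k \<star> (l \<star> b) \<in> T" using BK[of "l \<star> b" k] Kd l b kc by simp
      have "(k \<boxdot> l) \<star> b = k \<star> (l \<star> b) \<boxplus> t \<boxplus> ?p (Suc j)"
        using mul_star[of k l b] kc Kd(4) l b pc Tc[OF t'] Tc[OF t] xc by (simp add: e add_assoc)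
      moreover have "k \<star> (l \<star> b) \<boxplus> t \<in> T" using subgroup.m_closed[OF T t' t] by simp
      moreover have "k \<boxdot> l \<in> K" using Kd(12) k l by blast
      ultimately show ?case by blast
    qed
    \<comment> \<open>If \<open>l = z \<boxplus> f\<close> with \<open>z\<close> central, then
      \<open>l = f \<boxdot> z\<close> and \<open>l \<star> b = f \<star> b\<close>. The multiples
      of \<open>k \<star> b\<close> therefore take finitely many values.\<close>
    have "range ?p \<subseteq> (\<lambda>(t, y). \<boxminus> t \<boxplus> y) ` (T \<times> (\<lambda>f. f \<star> b) ` F)"
    proof
      fix y assume "y \<in> range ?p"
      then obtain j where y: "y = ?p j" by blast
      obtain l t where l: "l \<in> K" and t: "t \<in> T" and e: "l \<star> b = t \<boxplus> ?p j" using step by blast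
      obtain f z where fz: "f \<in> F" "z \<in> bzeta B" "l = z \<boxplus> f" using KF[OF l] by blast
      have fc: "f \<in> bcar B" using fz F Kd(4) by blast
      have zc: "z \<in> bcar B" using bzetaD(1)[OF fz(2) fc] .
      have "\<Lambda> l b = \<Lambda> f b"
        using lam_mul[OF fc zc b] bzetaD(5)[OF fz(2) fc] bzetaD(2)[OF fz(2) b] fz(3) by simp
      then have "l \<star> b = f \<star> b" using fc b l Kd(4) by (simp add: star_eq)
      with e have "y = \<boxminus> t \<boxplus> f \<star> b" using pc Tc[OF t] y by simp
      then show "y \<in> (\<lambda>(t, y). \<boxminus> t \<boxplus> y) ` (T \<times> (\<lambda>f. f \<star> b) ` F)" using t fz(1) by force
    qed
    then have "finite (range ?p)" by (rule finite_subset) (use finT F in blast)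
    \<comment> \<open>Two multiples with different indices coincide, and their difference shows that
      \<open>k \<star> b\<close> is torsion.\<close>
    then have "\<not> inj ?p" using finite_imageD infinite_UNIV_nat by blast
    then obtain i j where ij: "i < j" "?p i = ?p j"
      unfolding inj_def by (metis linorder_neqE_nat)
    have "?p i \<boxplus> ?p (j - i) = ?p j"
      using A.nat_pow_mult[of ?x i "j - i"] xc ij by simp
    then have "?p (j - i) = \<^bold>0"
      using ij(2) pc by (metis add_neg_cancel(1) add_neg(1))
    then have "torsion (addG B) ?x" using ij by (auto simp: torsion_def intro!: exI[of _ "j - i"])
    then show ?thesis using x by (simp add: T_def)
  qed
  have "bracket K \<subseteq> T" by (rule bracket_subset[OF T]) (use KB BK comm in blast)
  then show ?thesis using finT finite_subset by blast
qed

subsection \<open>Quotient braces\<close>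

text \<open>The first part expands \<open>h \<boxdot> x\<close> as
  \<open>h \<boxplus> h \<star> x \<boxplus> x\<close>. For the second,
  \<open>h \<boxplus> x = x \<boxplus> g\<close> with \<open>g\<close> the conjugate of
  \<open>h\<close>, and \<open>x \<boxplus> g = x \<boxdot> \<Lambda> y g\<close> for
  \<open>y\<close> the multiplicative inverse of \<open>x\<close>.\<close>

lemma mul_coset_exchange:
  assumes I: "star_ideal I" and x: "x \<in> bcar B" and h: "h \<in> I"
  shows "\<exists>h'\<in>I. h \<boxdot> x = h' \<boxplus> x" and "\<exists>h'\<in>I. h \<boxplus> x = x \<boxdot> h'"
proof -
  note Id = star_idealD[OF I]
  have hc: "h \<in> bcar B" using Id(4) h .
  have "h \<boxdot> x = (h \<boxplus> h \<star> x) \<boxplus> x" using x hc by (simp add: mul_eq lam_eq add_assoc)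
  then show "\<exists>h'\<in>I. h \<boxdot> x = h' \<boxplus> x" using Id(5)[OF h Id(8)[OF h x]] by blast
  define y where "y = inv\<^bsub>mulG B\<^esub> x"
  have y: "y \<in> bcar B" "x \<boxdot> y = \<^bold>0"
    using M.inv_closed[of x] M.r_inv[of x] x by (simp_all add: y_def bone_eq)
  define g where "g = \<boxminus> x \<boxplus> h \<boxplus> x"
  have g: "g \<in> I" unfolding g_def by (rule Id(10)[OF h x])
  have gc: "g \<in> bcar B" using Id(4) g .
  have "x \<boxdot> \<Lambda> y g = x \<boxplus> \<Lambda> (x \<boxdot> y) g"
    by (simp only: lam_mul[OF x y(1) gc] mul_eq[OF x lam_closed[OF y(1) gc]])
  also have "\<dots> = h \<boxplus> x" using y gc x hc by (simp add: g_def add_assoc)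
  finally show "\<exists>h'\<in>I. h \<boxplus> x = x \<boxdot> h'" using Id(11)[OF g y(1)] by metis
qed

lemma star_ideal_normal_mulG:
  assumes I: "star_ideal I"
  shows "I \<lhd> mulG B"
proof -
  note Id = star_idealD[OF I]
  have swap: "\<exists>h'\<in>I. h \<boxdot> x = x \<boxdot> h'" if "x \<in> bcar B" "h \<in> I" for x h
    using mul_coset_exchange[OF I that(1)] that(2) by metis
  have "subgroup I (mulG B)"
  proof (rule M.subgroupI)
    show "I \<noteq> {}" using Id(3) by blast
    show "I \<subseteq> carrier (mulG B)" using Id(4) by auto
    fix x assume x: "x \<in> I"
    then have xc: "x \<in> bcar B" by (rule Id(4))
    define y where "y = inv\<^bsub>mulG B\<^esub> x"
    have y: "y \<in> bcar B" "y \<boxdot> x = \<^bold>0"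
      using M.inv_closed[of x] M.l_inv[of x] xc by (simp_all add: y_def bone_eq)
    have L: "\<Lambda> y x \<in> I" using Id(11) x y by blast
    have "y \<boxplus> \<Lambda> y x = \<^bold>0" using mul_eq[OF y(1) xc] y(2) by simp
    then have "y = \<boxminus> \<Lambda> y x"
      using A.inv_equality[of y "\<Lambda> y x"] y xc by simp
    then show "inv\<^bsub>mulG B\<^esub> x \<in> I" using Id(6)[OF L] by (simp add: y_def)
  next
    fix x y assume "x \<in> I" "y \<in> I"
    then show "x \<otimes>\<^bsub>mulG B\<^esub> y \<in> I" using Id(12) by simp
  qed
  moreover have "x \<boxdot> h \<boxdot> inv\<^bsub>mulG B\<^esub> x \<in> I" if x: "x \<in> bcar B" and h: "h \<in> I" for x h
  proof -
    have yc: "inv\<^bsub>mulG B\<^esub> x \<in> bcar B" using M.inv_closed[of x] x by simp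
    obtain h' where h': "h' \<in> I" "h \<boxdot> inv\<^bsub>mulG B\<^esub> x = inv\<^bsub>mulG B\<^esub> x \<boxdot> h'"
      using swap[OF yc h] by blast
    have "x \<boxdot> h \<boxdot> inv\<^bsub>mulG B\<^esub> x = x \<boxdot> (inv\<^bsub>mulG B\<^esub> x \<boxdot> h')"
      using mul_assoc[OF x Id(4)[OF h] yc] h'(2) by simp
    also have "\<dots> = h'" using M.inv_cancel_left(2)[of x h'] x Id(4)[OF h'(1)] by simp
    finally show ?thesis using h' by simp
  qed
  ultimately show ?thesis by (simp add: M.normal_inv_iff)
qed

text \<open>The exchange inclusions \<open>Ix \<subseteq> I + x \<subseteq> xI\<close> close up
  because \<open>I\<close> is normal in the multiplicative group.\<close>

lemma mulG_coset_eq: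
  assumes I: "star_ideal I" and x: "x \<in> bcar B"
  shows "I #>\<^bsub>mulG B\<^esub> x = I #>\<^bsub>addG B\<^esub> x"
proof
  show "I #>\<^bsub>mulG B\<^esub> x \<subseteq> I #>\<^bsub>addG B\<^esub> x"
    using mul_coset_exchange(1)[OF I x] by (auto simp: r_coset_def)
  have "I #>\<^bsub>addG B\<^esub> x \<subseteq> x <#\<^bsub>mulG B\<^esub> I"
    using mul_coset_exchange(2)[OF I x] by (auto simp: r_coset_def l_coset_def)
  then show "I #>\<^bsub>addG B\<^esub> x \<subseteq> I #>\<^bsub>mulG B\<^esub> x"
    using normal.coset_eq[OF star_ideal_normal_mulG[OF I]] x by auto
qed

lemma addG_quot: "addG (quot B I) = addG B Mod I"
  unfolding addG_def[of "quot B I"] by (simp add: quot_def FactGroup_def)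

text \<open>\<open>quot\<close> takes additive cosets as its carrier for both operations; the
  coincidence of cosets makes its multiplicative group a genuine factor group.\<close>

lemma mulG_quot:
  assumes "star_ideal I"
  shows "mulG (quot B I) = mulG B Mod I"
proof -
  have "rcosets\<^bsub>mulG B\<^esub> I = rcosets\<^bsub>addG B\<^esub> I"
    unfolding RCOSETS_def using mulG_coset_eq[OF assms] by simp
  then show ?thesis unfolding mulG_def[of "quot B I"] by (simp add: quot_def FactGroup_def)
qed

lemma bcar_quot: "bcar (quot B I) = (\<lambda>x. I #>\<^bsub>addG B\<^esub> x) ` bcar B"
  by (auto simp: quot_def RCOSETS_def)

end

section \<open>Surjective brace homomorphisms\<close>

locale brace_hom = B: skew_brace B + Q: skew_brace Q for B :: "'a brace" and Q :: "'b brace" +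
  fixes \<pi> :: "'a \<Rightarrow> 'b"
  assumes hom_addG: "\<pi> \<in> hom (addG B) (addG Q)" and hom_mulG: "\<pi> \<in> hom (mulG B) (mulG Q)"
    and onto: "\<pi> ` bcar B = bcar Q"
begin

sublocale A: group_hom "addG B" "addG Q" \<pi> by unfold_locales (rule hom_addG)

lemma closed: "x \<in> bcar B \<Longrightarrow> \<pi> x \<in> bcar Q"
  using onto by blast

lemma hom_add: "x \<in> bcar B \<Longrightarrow> y \<in> bcar B \<Longrightarrow> \<pi> (badd B x y) = badd Q (\<pi> x) (\<pi> y)"
  using hom_mult[OF hom_addG, of x y] by simp

lemma hom_mul: "x \<in> bcar B \<Longrightarrow> y \<in> bcar B \<Longrightarrow> \<pi> (bmul B x y) = bmul Q (\<pi> x) (\<pi> y)"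
  using hom_mult[OF hom_mulG, of x y] by simp

lemma hom_neg: "x \<in> bcar B \<Longrightarrow> \<pi> (bneg B x) = bneg Q (\<pi> x)"
  using A.hom_inv[of x] by simp

lemma hom_star: "x \<in> bcar B \<Longrightarrow> y \<in> bcar B \<Longrightarrow> \<pi> (bstar B x y) = bstar Q (\<pi> x) (\<pi> y)"
  by (simp add: bstar_def hom_add hom_mul hom_neg)

lemma hom_add_comm: "x \<in> bcar B \<Longrightarrow> y \<in> bcar B \<Longrightarrow> \<pi> (add_comm B x y) = add_comm Q (\<pi> x) (\<pi> y)"
  by (simp add: add_comm_def hom_add hom_neg)

lemma vimage_subgroup:
  assumes S: "subgroup S (addG Q)"
  shows "subgroup {x \<in> bcar B. \<pi> x \<in> S} (addG B)"
proof (rule B.A.subgroupI)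
  have "bzero B \<in> {x \<in> bcar B. \<pi> x \<in> S}" using subgroup.one_closed[OF S] A.hom_one by simp
  then show "{x \<in> bcar B. \<pi> x \<in> S} \<noteq> {}" by blast
next
  fix x assume "x \<in> {x \<in> bcar B. \<pi> x \<in> S}"
  then show "inv\<^bsub>addG B\<^esub> x \<in> {x \<in> bcar B. \<pi> x \<in> S}"
    using subgroup.m_inv_closed[OF S, of "\<pi> x"] by (simp add: hom_neg)
next
  fix x y assume "x \<in> {x \<in> bcar B. \<pi> x \<in> S}" "y \<in> {x \<in> bcar B. \<pi> x \<in> S}"
  then show "x \<otimes>\<^bsub>addG B\<^esub> y \<in> {x \<in> bcar B. \<pi> x \<in> S}"
    using subgroup.m_closed[OF S, of "\<pi> x" "\<pi> y"] by (simp add: hom_add)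
qed auto

lemma star_ideal_vimage:
  assumes I: "Q.star_ideal I"
  shows "B.star_ideal {x \<in> bcar B. \<pi> x \<in> I}"
proof -
  note Id = Q.star_idealD[OF I]
  have "{x \<in> bcar B. \<pi> x \<in> I} \<lhd> addG B"
    using vimage_subgroup[OF Id(2)] Id(9) closed
    by (simp add: B.A.normal_inv_iff hom_add hom_neg)
  then show ?thesis using Id(7,8) closed by (simp add: B.star_ideal_def hom_star)
qed

lemma star_ideal_image:
  assumes I: "B.star_ideal I"
  shows "Q.star_ideal (\<pi> ` I)"
proof -
  note Id = B.star_idealD[OF I]
  have "subgroup (\<pi> ` I) (addG Q)" by (rule A.subgroup_img_is_subgroup[OF Id(2)])
  moreover have "badd Q (badd Q (\<pi> b) (\<pi> x)) (bneg Q (\<pi> b)) \<in> \<pi> ` I"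
    "bstar Q (\<pi> b) (\<pi> x) \<in> \<pi> ` I" "bstar Q (\<pi> x) (\<pi> b) \<in> \<pi> ` I" if "b \<in> bcar B" "x \<in> I" for b x
  proof -
    have x: "x \<in> bcar B" using Id(4) that by blast
    show "badd Q (badd Q (\<pi> b) (\<pi> x)) (bneg Q (\<pi> b)) \<in> \<pi> ` I"
      using imageI[OF Id(9)[OF that(2,1)], of \<pi>] that x by (simp add: hom_add hom_neg)
    show "bstar Q (\<pi> b) (\<pi> x) \<in> \<pi> ` I" "bstar Q (\<pi> x) (\<pi> b) \<in> \<pi> ` I"
      using imageI[OF Id(7)[OF that(2,1)], of \<pi>] imageI[OF Id(8)[OF that(2,1)], of \<pi>] that x
      by (simp_all add: hom_star)
  qed
  ultimately show ?thesis
    by (simp add: Q.star_ideal_def Q.A.normal_inv_iff flip: onto)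
qed

text \<open>The preimage of the target bracket is a subgroup containing every generator of
  \<open>B.bracket K\<close>.\<close>

lemma image_bracket_subset:
  assumes K: "K \<subseteq> bcar B"
  shows "\<pi> ` B.bracket K \<subseteq> Q.bracket (\<pi> ` K)"
proof -
  have gens: "bstar Q (\<pi> k) b \<in> Q.bracket (\<pi> ` K)" "bstar Q b (\<pi> k) \<in> Q.bracket (\<pi> ` K)"
    "add_comm Q (\<pi> k) b \<in> Q.bracket (\<pi> ` K)" if "k \<in> K" "b \<in> bcar Q" for k b
    using Q.bracket_gens[OF imageI[OF that(1)] that(2)] by auto
  have "subgroup (Q.bracket (\<pi> ` K)) (addG Q)"
    using K closed by (intro Q.subgroup_bracket) blast
  then have "B.bracket K \<subseteq> {x \<in> bcar B. \<pi> x \<in> Q.bracket (\<pi> ` K)}"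
  proof (intro B.bracket_subset vimage_subgroup)
    fix k b assume "k \<in> K" "b \<in> bcar B"
    moreover from this have "k \<in> bcar B" using K by blast
    ultimately show "bstar B k b \<in> {x \<in> bcar B. \<pi> x \<in> Q.bracket (\<pi> ` K)} \<and>
      bstar B b k \<in> {x \<in> bcar B. \<pi> x \<in> Q.bracket (\<pi> ` K)} \<and>
      add_comm B k b \<in> {x \<in> bcar B. \<pi> x \<in> Q.bracket (\<pi> ` K)}"
      using gens closed by (simp add: hom_star hom_add_comm B.add_comm_closed)
  qed
  then show ?thesis by blast
qed

end

section \<open>Quotient maps and the upper central series\<close>

context skew_brace
begin

lemma brace_hom_quot:
  assumes I: "star_ideal I"
  shows "brace_hom B (quot B I) (\<lambda>x. I #>\<^bsub>addG B\<^esub> x)"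
proof -
  define Q where "Q = quot B I"
  define \<pi> where "\<pi> = (\<lambda>x. I #>\<^bsub>addG B\<^esub> x)"
  note nA = star_idealD(1)[OF I] and nM = star_ideal_normal_mulG[OF I]
  have gA: "group (addG Q)" and gM: "group (mulG Q)"
    using normal.factorgroup_is_group[OF nA] normal.factorgroup_is_group[OF nM]
    by (simp_all add: addG_quot mulG_quot[OF I] Q_def)
  have onto: "\<pi> ` bcar B = bcar Q" by (simp add: Q_def \<pi>_def bcar_quot)
  have hA: "\<pi> \<in> hom (addG B) (addG Q)"
    using normal.r_coset_hom_Mod[OF nA] by (simp add: Q_def \<pi>_def addG_quot)
  \<comment> \<open>The canonical multiplicative quotient map is the same function as
    \<open>\<pi>\<close>, since both kinds of cosets agree.\<close>
  have "(\<lambda>x. I #>\<^bsub>mulG B\<^esub> x) \<in> hom (mulG B) (mulG Q)"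
    using normal.r_coset_hom_Mod[OF nM] by (simp add: Q_def mulG_quot[OF I])
  then have hM: "\<pi> \<in> hom (mulG B) (mulG Q)"
    by (simp add: hom_def Pi_iff \<pi>_def mulG_coset_eq[OF I])
  interpret h: group_hom "addG B" "addG Q" \<pi> using gA hA A.is_group by (simp add: group_hom_def group_hom_axioms_def)
  have add: "badd Q (\<pi> x) (\<pi> y) = \<pi> (x \<boxplus> y)" and mul: "bmul Q (\<pi> x) (\<pi> y) = \<pi> (x \<boxdot> y)"
    and neg: "bneg Q (\<pi> x) = \<pi> (\<boxminus> x)" if "x \<in> bcar B" "y \<in> bcar B" for x y
    using hom_mult[OF hA, of x y] hom_mult[OF hM, of x y] h.hom_inv[of x] that by simp_all
  have "is_brace Q"
    unfolding is_brace_def onto[symmetric] using gA gM by (auto simp: add mul neg mul_add)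
  then interpret Q: skew_brace Q by unfold_locales
  show ?thesis
    unfolding Q_def[symmetric] \<pi>_def[symmetric] by unfold_locales (fact hA hM onto)+
qed

text \<open>Rewrites the next term of \<open>upper_zeta\<close> as a preimage under the quotient
  map, so that \<open>star_ideal_vimage\<close> applies to it.\<close>

lemma Union_bzeta_quot:
  assumes I: "star_ideal I"
  shows "\<Union> (bzeta (quot B I)) = {x \<in> bcar B. I #>\<^bsub>addG B\<^esub> x \<in> bzeta (quot B I)}"
proof -
  interpret Q: brace_hom B "quot B I" "\<lambda>x. I #>\<^bsub>addG B\<^esub> x" by (rule brace_hom_quot[OF I])
  note S = star_idealD(2)[OF I]
  show ?thesis
  proof (intro equalityI subsetI)
    fix x assume "x \<in> \<Union> (bzeta (quot B I))"
    then obtain U where U: "U \<in> bzeta (quot B I)" "x \<in> U" by blast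
    then have "U \<in> bcar (quot B I)" by (simp add: Q.Q.bzeta_iff)
    then obtain y where y: "y \<in> bcar B" "U = I #>\<^bsub>addG B\<^esub> y" by (auto simp: bcar_quot)
    have "x \<in> bcar B" using U(2) y star_idealD(4)[OF I] by (auto simp: r_coset_def)
    moreover have "I #>\<^bsub>addG B\<^esub> x = U" using A.repr_independence[of x I y] U(2) y S by simp
    ultimately show "x \<in> {x \<in> bcar B. I #>\<^bsub>addG B\<^esub> x \<in> bzeta (quot B I)}" using U by simp
  next
    fix x assume "x \<in> {x \<in> bcar B. I #>\<^bsub>addG B\<^esub> x \<in> bzeta (quot B I)}"
    then show "x \<in> \<Union> (bzeta (quot B I))" using A.rcos_self[of x I] S by auto
  qed
qed

lemma star_ideal_upper_zeta: "star_ideal (upper_zeta B k)"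
proof (induction k)
  case 0
  have "star_ideal {\<^bold>0}"
    using A.one_is_normal group_hom.hom_one[OF lam_group_hom]
    by (simp add: star_ideal_def star_eq)
  then show ?case by simp
next
  case (Suc k)
  interpret Q: brace_hom B "quot B (upper_zeta B k)" "\<lambda>x. upper_zeta B k #>\<^bsub>addG B\<^esub> x"
    by (rule brace_hom_quot[OF Suc])
  show ?case
    using Q.star_ideal_vimage[OF Q.Q.star_ideal_bzeta] by (simp add: Union_bzeta_quot[OF Suc])
qed

text \<open>The chain of ideals itself is the series: an infinite cyclic factor is covered by the
  powers of a lifted generator, a factor of prime order by finitely many coset
  representatives.\<close>

lemma supersoluble_imp_virtually_polycyclic:
  assumes "supersoluble B"
  shows "virtually_polycyclic (addG B)"
proof -
  obtain I m where I0: "I (0::nat) = {\<^bold>0}" and Im: "I m = bcar B"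
    and ideal: "\<And>i. i \<le> m \<Longrightarrow> brace_ideal (I i) B"
    and factor: "\<And>i. i < m \<Longrightarrow> (\<exists>g\<in>quot_sub B (I (Suc i)) (I i).
             quot_sub B (I (Suc i)) (I i) = generate (addG (quot B (I i))) {g})
         \<or> Factorial_Ring.prime (card (quot_sub B (I (Suc i)) (I i)))"
    using assms unfolding supersoluble_def by metis
  have nor: "I i \<lhd> addG B" if "i \<le> m" for i using ideal[OF that] by (simp add: brace_ideal_def)
  have "(\<exists>g\<in>carrier (addG B). I (Suc i) \<subseteq> {h \<otimes>\<^bsub>addG B\<^esub> g [^]\<^bsub>addG B\<^esub> (k::int) | h k. h \<in> I i}) \<or>
       (\<exists>F\<subseteq>carrier (addG B). finite F \<and> I (Suc i) \<subseteq> I i <#>\<^bsub>addG B\<^esub> F)" if i: "i < m" for i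
  proof -
    let ?q = "\<lambda>x. I i #>\<^bsub>addG B\<^esub> x"
    interpret N: normal "I i" "addG B" using nor i by simp
    interpret Q: group "addG B Mod I i" by (rule N.factorgroup_is_group)
    have sub: "subgroup (I (Suc i)) (addG B)" using nor[of "Suc i"] i normal_imp_subgroup by auto
    have self: "x \<in> I i #>\<^bsub>addG B\<^esub> y" if "x \<in> I (Suc i)" "?q x = ?q y" for x y
      using A.rcos_self[OF subgroup.mem_carrier[OF sub that(1)] N.subgroup_axioms] that(2) by simp
    have qs: "quot_sub B (I (Suc i)) (I i) = ?q ` I (Suc i)" by (auto simp: quot_sub_def)
    from factor[OF i] show ?thesis
    proof
      assume "\<exists>g\<in>quot_sub B (I (Suc i)) (I i). quot_sub B (I (Suc i)) (I i) = generate (addG (quot B (I i))) {g}"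
      then obtain g where g: "g \<in> I (Suc i)" and gen: "?q ` I (Suc i) = generate (addG B Mod I i) {?q g}"
        by (auto simp: qs addG_quot)
      have gc: "g \<in> carrier (addG B)" using subgroup.mem_carrier[OF sub g] .
      then have gq: "?q g \<in> carrier (addG B Mod I i)" by (auto simp: carrier_FactGroup)
      have "I (Suc i) \<subseteq> {h \<otimes>\<^bsub>addG B\<^esub> g [^]\<^bsub>addG B\<^esub> (k::int) | h k. h \<in> I i}"
      proof
        fix x assume x: "x \<in> I (Suc i)"
        then have "?q x \<in> generate (addG B Mod I i) {?q g}" using gen by blast
        then obtain k :: int where "?q x = ?q g [^]\<^bsub>addG B Mod I i\<^esub> k"
          using Q.generate_pow[OF gq] by blast
        then have "?q x = ?q (g [^]\<^bsub>addG B\<^esub> k)" using N.FactGroup_int_pow[OF gc] by simp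
        then obtain h where "h \<in> I i" "x = h \<otimes>\<^bsub>addG B\<^esub> g [^]\<^bsub>addG B\<^esub> k"
          using self[OF x] unfolding r_coset_def by blast
        then show "x \<in> {h \<otimes>\<^bsub>addG B\<^esub> g [^]\<^bsub>addG B\<^esub> (k::int) | h k. h \<in> I i}" by blast
      qed
      then show ?thesis using gc by (intro disjI1 bexI[where x = g])
    next
      assume "Factorial_Ring.prime (card (quot_sub B (I (Suc i)) (I i)))"
      \<comment> \<open>An infinite set has \<open>card\<close> equal to \<open>0\<close>, which is
        not prime, so the factor is finite.\<close>
      then have "card (?q ` I (Suc i)) \<noteq> 0" by (metis not_prime_0 qs)
      then have "finite (?q ` I (Suc i))" by (rule card_ge_0_finite[OF neq0_conv[THEN iffD1]])
      then obtain F where F: "F \<subseteq> I (Suc i)" "finite F" "?q ` I (Suc i) = ?q ` F"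
        using finite_subset_image[of "?q ` I (Suc i)" ?q "I (Suc i)"] by blast
      have "I (Suc i) \<subseteq> I i <#>\<^bsub>addG B\<^esub> F"
      proof
        fix x assume x: "x \<in> I (Suc i)"
        then obtain f where f: "f \<in> F" "?q x = ?q f" using F(3) by blast
        then show "x \<in> I i <#>\<^bsub>addG B\<^esub> F" using self[OF x f(2)] by (auto simp: r_coset_def set_mult_def)
      qed
      moreover have "F \<subseteq> carrier (addG B)" using F(1) subgroup.subset[OF sub] by blast
      ultimately show ?thesis using F(2) by (intro disjI2 exI[where x = F] conjI)
    qed
  qed
  then show ?thesis
    unfolding virtually_polycyclic_def
    by (intro exI[where x = I] exI[where x = m] conjI allI impI)
      (simp_all only: I0 Im nor addG_simps)
qed

text \<open>In \<open>quot B L\<close> the image of \<open>L'\<close> is the centre, so finiteness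
  of \<open>K\<close> modulo \<open>L'\<close> says that the image of \<open>K\<close> is finite
  modulo the centre. Then \<open>finite_bracket\<close> applies there, and the image of
  \<open>bracket K\<close> lies in the bracket of the image.\<close>

lemma finite_image_Gamma_Suc:
  assumes vp: "virtually_polycyclic (addG B)"
    and fin: "finite ((\<lambda>x. upper_zeta B (Suc j) #>\<^bsub>addG B\<^esub> x) ` Gamma B (Suc k))"
  shows "finite ((\<lambda>x. upper_zeta B j #>\<^bsub>addG B\<^esub> x) ` Gamma B (Suc (Suc k)))"
proof -
  define L where "L = upper_zeta B j"
  define L' where "L' = upper_zeta B (Suc j)"
  define K where "K = Gamma B (Suc k)"
  define \<pi> where "\<pi> = (\<lambda>x. L #>\<^bsub>addG B\<^esub> x)"
  have L: "star_ideal L" and L': "star_ideal L'" and K: "star_ideal K"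
    unfolding L_def L'_def K_def by (rule star_ideal_upper_zeta star_ideal_Gamma)+
  have Kc: "K \<subseteq> bcar B" using star_idealD(4)[OF K] by blast
  interpret Q: brace_hom B "quot B L" \<pi> unfolding \<pi>_def by (rule brace_hom_quot[OF L])
  have L'_eq: "L' = {x \<in> bcar B. \<pi> x \<in> bzeta (quot B L)}"
    using Union_bzeta_quot[OF L] by (simp add: L'_def L_def \<pi>_def)
  have vpQ: "virtually_polycyclic (addG (quot B L))"
    by (rule virtually_polycyclic_image[OF A.is_group Q.Q.A.is_group Q.hom_addG _ vp]) (simp add: Q.onto)
  \<comment> \<open>\<open>F\<close> contains a representative in \<open>K\<close> of each coset of
    \<open>L'\<close> that meets \<open>K\<close>.\<close>
  obtain F where F: "F \<subseteq> K" "finite F" "(\<lambda>x. L' #>\<^bsub>addG B\<^esub> x) ` K = (\<lambda>x. L' #>\<^bsub>addG B\<^esub> x) ` F"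
    using finite_subset_image[OF fin[folded L'_def K_def] order_refl] by blast
  have "finite (Q.Q.bracket (\<pi> ` K))"
  proof (rule Q.Q.finite_bracket[OF vpQ Q.star_ideal_image[OF K]])
    show "finite (\<pi> ` F)" "\<pi> ` F \<subseteq> \<pi> ` K" using F by auto
    fix u assume "u \<in> \<pi> ` K"
    then obtain x where x: "x \<in> K" "u = \<pi> x" by blast
    obtain f where f: "f \<in> F" "L' #>\<^bsub>addG B\<^esub> x = L' #>\<^bsub>addG B\<^esub> f" using F(3) x by blast
    have "x \<in> L' #>\<^bsub>addG B\<^esub> x"
      using A.rcos_self[of x L'] star_idealD(2)[OF L'] x Kc by auto
    then obtain z where z: "z \<in> L'" "x = z \<boxplus> f" unfolding f(2) by (auto simp: r_coset_def)
    have "u = badd (quot B L) (\<pi> z) (\<pi> f)"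
      using Q.hom_add[of z f] z x(2) star_idealD(4)[OF L' z(1)] f(1) F(1) Kc by auto
    then show "\<exists>f\<in>\<pi> ` F. \<exists>z\<in>bzeta (quot B L). u = badd (quot B L) z f"
      using z(1) f(1) L'_eq by blast
  qed
  then have "finite (\<pi> ` bracket K)"
    using Q.image_bracket_subset[OF Kc] finite_subset by blast
  then show ?thesis unfolding Gamma_Suc_Suc L_def \<pi>_def K_def .
qed

end

theorem theorem3p47:
  fixes B :: "'a brace" and n :: nat
  assumes "is_brace B"
    and "supersoluble B"
    and "finite (bcar (quot B (upper_zeta B n)))"
  shows "finite (Gamma B (Suc n))"
proof -
  interpret skew_brace B by unfold_locales (rule assms(1))
  note vp = supersoluble_imp_virtually_polycyclic[OF assms(2)]
  \<comment> \<open>Each step lowers the index of \<open>upper_zeta\<close> and raises that of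
    \<open>Gamma\<close>. The start \<open>k = 0\<close> is the finiteness assumption, as
    \<open>Gamma B (Suc 0)\<close> is all of \<open>B\<close>; at \<open>k = n\<close> the
    denominator is zero.\<close>
  have "finite ((\<lambda>x. upper_zeta B (n - k) #>\<^bsub>addG B\<^esub> x) ` Gamma B (Suc k))" if "k \<le> n" for k
    using that
  proof (induction k)
    case 0
    then show ?case using assms(3) by (simp add: bcar_quot)
  next
    case (Suc k)
    then have "Suc (n - Suc k) = n - k" by simp
    with Suc show ?case using finite_image_Gamma_Suc[OF vp, of "n - Suc k" k] by simp
  qed
  from this[of n] have "finite ((\<lambda>x. {\<^bold>0} #>\<^bsub>addG B\<^esub> x) ` Gamma B (Suc n))" by simp
  \<comment> \<open>Cosets of the zero ideal are singletons, so counting them counts the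
    elements.\<close>
  then have "finite ((\<lambda>x. {x}) ` Gamma B (Suc n))"
    using star_idealD(4)[OF star_ideal_Gamma] by (simp add: r_coset_def cong: image_cong_simp)
  then show ?thesis by (rule finite_imageD) simp
qed

end
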